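(* Suppose that for every altitude $h_\ast\in[h_-,h_+]$ the robot can circumnavigate the horizontal slice $\gamma(h_\ast)$ of $B$, moving in $D_{\text{out}}$ and in the horizontal plane $\{\boldsymbol r: h(\boldsymbol r)=h_\ast\}$, while always maintaining the distance $d_0$ to $\gamma(h_\ast)$. Then $$R=\frac{v}{\overline{u}}\le \frac{\sin\theta_b}{|\mathbf{II}_b[T_0;T_0]|}+d_0\,\operatorname{sgn}\mathbf{II}_b[T_0;T_0]$$ for any $b\in B$, where $T_0:=T_0(b)$, $a/0:=\infty$ for all $a>0$, and $\operatorname{sgn}0:=0$.
   Context: Robot model: $\dot{\boldsymbol r}=v\vec{\imath}$, $\dot{\vec{\imath}}=\vec u$, $\langle\vec u;\vec{\imath}\rangle=0$, $\|\vec u\|\le\overline u$, where $\boldsymbol r\in\mathbb R^3$ is the position, $\vec{\imath}$ is a unit vector (orientation), $v>0$ is the constant speed, $\vec u$ is the control, and $\overline u>0$ is given; $R:=v/\overline u$ is the minimal turning radius. A unit vector $\vec h\in\mathbb R^3$ ("vertical") is given; $h(\boldsymbol r)=\langle\boldsymbol r;\vec h\rangle+\text{const}$ is the altitude. "Horizontal" means orthogonal to $\vec h$. A desired distance $d_0>0$ and altitudes $h_-<h_+$ are given, and $L=\{\boldsymbol r:h_-\le h(\boldsymbol r)\le h_+\}$. $D\subset\mathbb R^3$ is a compact 3-dimensional $C^3$-smooth manifold with boundary $\partial D$, and $B_\dagger$ is a connected component of $\partial D$. Within $L$ the unit normal $N_b$ to $\partial D$ directed inwards $D$ is not co-linear to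 $\vec h$ at any $b\in B_\dagger$. $B$ is a connected component of $B_\dagger\cap L$. $D_{\text{out}}$ is the part of the free space (complement of $D$) in the layer $L$ whose boundary includes $B$. The horizontal distance is $d(\boldsymbol r)=\min\{\|\boldsymbol r-\boldsymbol r'\|:\boldsymbol r'\in D,\ h(\boldsymbol r')=h(\boldsymbol r)\}$; the distance of interest is the one to $B$, and $b_{\boldsymbol r}$ is the point of $B$ horizontally nearest to $\boldsymbol r$. It is assumed that $b_{\boldsymbol r}$ is unique for any $\boldsymbol r\in D_{\text{out}}$ at a horizontal distance $d_0$ from $B$, and that such locations exist. Notation for $b\in B$: $\mathscr T_b$ is the tangent plane to $B$ at $b$; $\theta_b\in(0,\pi)$ is the angle between $N_b$ and $\vec h$; $S_b(V)=-D_VN$ is the shape operator ($D_V$ is the derivative in the tangent direction $V$); $\mathbf{II}_b[V;W]=\langle S_b(V);W\rangle$ is the second fundamental form; $T_0(b)=\frac{N_b\times\vec h}{\sin\theta_b}$; $\gamma(h_\ast)=\{b\in B:h(b)=h_\ast\}$. "Circumnavigating $\gamma(h_\ast)$" means performing an admissible motion of the robot model during which the nearest point $b_{\boldsymbol r(t)}$ runs over the whole closed curve $\gamma(h_\ast)$. *)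

theory Defs
  imports "HOL-Analysis.Analysis"
begin

section \<open>Smooth domains and the geometry of their boundaries\<close>

text \<open>\<open>Ck_on k f U\<close> is meant for open \<open>U\<close>: all iterated directional derivatives of \<open>f\<close>
  up to order \<open>k\<close> exist and are continuous on \<open>U\<close>.\<close>

fun Ck_on :: "nat \<Rightarrow> ('a::real_normed_vector \<Rightarrow> 'b::real_normed_vector) \<Rightarrow> 'a set \<Rightarrow> bool" where
  "Ck_on 0 f U \<longleftrightarrow> continuous_on U f"
| "Ck_on (Suc k) f U \<longleftrightarrow> (\<forall>x\<in>U. f differentiable (at x)) \<and>
     (\<forall>w. Ck_on k (\<lambda>x. frechet_derivative f (at x) w) U)"

definition Ck_diffeo ::
  "nat \<Rightarrow> (real^3) set \<Rightarrow> (real^3) set \<Rightarrow> (real^3 \<Rightarrow> real^3) \<Rightarrow> (real^3 \<Rightarrow> real^3) \<Rightarrow> bool" where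
  "Ck_diffeo k U V \<phi> \<psi> \<longleftrightarrow>
     open U \<and> open V \<and> homeomorphism U V \<phi> \<psi> \<and> Ck_on k \<phi> U \<and> Ck_on k \<psi> V"

text \<open>A subset of \<open>\<real>\<^sup>3\<close> that is a 3-dimensional manifold with boundary of class \<open>C\<^sup>k\<close>: near each of
  its points, an ambient \<open>C\<^sup>k\<close> change of coordinates straightens it to a closed half-space. If such a
  set is closed, its manifold boundary is its topological boundary \<^const>\<open>frontier\<close>.\<close>

definition Ck_domain :: "nat \<Rightarrow> (real^3) set \<Rightarrow> bool" where
  "Ck_domain k D \<longleftrightarrow> (\<forall>p\<in>D. \<exists>U V \<phi> \<psi>. p \<in> U \<and> Ck_diffeo k U V \<phi> \<psi> \<and>
     \<phi> ` (U \<inter> D) = V \<inter> {x. 0 \<le> x $ 3})"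

definition curve_through :: "(real^3) set \<Rightarrow> real^3 \<Rightarrow> real^3 \<Rightarrow> (real \<Rightarrow> real^3) \<Rightarrow> bool" where
  "curve_through S p V c \<longleftrightarrow> c 0 = p \<and> (c has_vector_derivative V) (at 0) \<and>
     (\<forall>\<^sub>F t in nhds 0. c t \<in> S)"

definition tangent_space :: "(real^3) set \<Rightarrow> real^3 \<Rightarrow> (real^3) set" where
  "tangent_space S p = {V. \<exists>c. curve_through S p V c}"

text \<open>Tangent vectors are taken with respect to the whole boundary \<open>\<partial>D\<close>: a component of its
  intersection with a layer has edges, but its tangent planes are those of \<open>\<partial>D\<close>.\<close>

definition inward_normal :: "(real^3) set \<Rightarrow> real^3 \<Rightarrow> real^3" where
  "inward_normal D b = (THE n. norm n = 1 \<and> (\<forall>V\<in>tangent_space (frontier D) b. orthogonal n V) \<and>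
     (\<forall>\<^sub>F t in at_right 0. b + t *\<^sub>R n \<in> interior D))"

text \<open>The derivative at \<open>p\<close> of a vector field \<open>X\<close> on the surface \<open>S\<close> in the tangent direction \<open>V\<close>.\<close>

definition surface_deriv ::
  "(real^3) set \<Rightarrow> (real^3 \<Rightarrow> real^3) \<Rightarrow> real^3 \<Rightarrow> real^3 \<Rightarrow> real^3" where
  "surface_deriv S X p V = (THE W. \<forall>c. curve_through S p V c \<longrightarrow>
     ((\<lambda>t. X (c t)) has_vector_derivative W) (at 0))"

definition shape_op :: "(real^3) set \<Rightarrow> real^3 \<Rightarrow> real^3 \<Rightarrow> real^3" where
  "shape_op D b V = - surface_deriv (frontier D) (inward_normal D) b V"

definition second_ff :: "(real^3) set \<Rightarrow> real^3 \<Rightarrow> real^3 \<Rightarrow> real^3 \<Rightarrow> real" where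
  "second_ff D b V W = shape_op D b V \<bullet> W"

definition angle_between :: "real^3 \<Rightarrow> real^3 \<Rightarrow> real" where
  "angle_between x y = arccos ((x \<bullet> y) / (norm x * norm y))"

section \<open>Altitude, horizontal slices and horizontal distance\<close>

text \<open>Throughout, \<open>hv\<close> is the unit vertical vector and \<open>a\<close> the additive constant in the altitude.\<close>

definition altitude :: "real^3 \<Rightarrow> real \<Rightarrow> real^3 \<Rightarrow> real" where
  "altitude hv a r = r \<bullet> hv + a"

definition layer :: "real^3 \<Rightarrow> real \<Rightarrow> real \<Rightarrow> real \<Rightarrow> (real^3) set" where
  "layer hv a hmin hmax = {r. hmin \<le> altitude hv a r \<and> altitude hv a r \<le> hmax}"

definition slice :: "real^3 \<Rightarrow> real \<Rightarrow> (real^3) set \<Rightarrow> real \<Rightarrow> (real^3) set" where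
  "slice hv a S z = {r \<in> S. altitude hv a r = z}"

text \<open>By the convention for \<^const>\<open>infdist\<close>, the value is 0 if the slice of \<open>S\<close> at the altitude
  of \<open>r\<close> is empty.\<close>

definition hdist :: "real^3 \<Rightarrow> real \<Rightarrow> (real^3) set \<Rightarrow> real^3 \<Rightarrow> real" where
  "hdist hv a S r = infdist r (slice hv a S (altitude hv a r))"

definition is_hnearest :: "real^3 \<Rightarrow> real \<Rightarrow> (real^3) set \<Rightarrow> real^3 \<Rightarrow> real^3 \<Rightarrow> bool" where
  "is_hnearest hv a S r b \<longleftrightarrow>
     b \<in> slice hv a S (altitude hv a r) \<and> dist r b = hdist hv a S r"

definition hnearest :: "real^3 \<Rightarrow> real \<Rightarrow> (real^3) set \<Rightarrow> real^3 \<Rightarrow> real^3" where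
  "hnearest hv a S r = (THE b. is_hnearest hv a S r b)"

definition unit_horizontal_tangent :: "(real^3) set \<Rightarrow> real^3 \<Rightarrow> real^3 \<Rightarrow> real^3" where
  "unit_horizontal_tangent D hv b =
     (1 / sin (angle_between (inward_normal D b) hv)) *\<^sub>R cross3 (inward_normal D b) hv"

section \<open>The robot\<close>

text \<open>Position \<open>r\<close>, orientation \<open>e\<close> and control \<open>u\<close> on the time interval \<open>[0, T]\<close>. The equation
  \<open>e' = u\<close> is imposed in integrated form (Caratheodory solutions), so that discontinuous controls
  are admitted; if \<open>e\<close> is differentiable with derivative \<open>u\<close> everywhere, the integrated form holds by
  the fundamental theorem of calculus for the gauge integral.\<close>

definition admissible_motion ::
  "real \<Rightarrow> real \<Rightarrow> real \<Rightarrow> (real \<Rightarrow> real^3) \<Rightarrow> (real \<Rightarrow> real^3) \<Rightarrow> (real \<Rightarrow> real^3) \<Rightarrow> bool" where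
  "admissible_motion v umax T r e u \<longleftrightarrow>
     (\<forall>t\<in>{0..T}. (r has_vector_derivative v *\<^sub>R e t) (at t within {0..T}) \<and>
        (u has_integral (e t - e 0)) {0..t} \<and>
        norm (e t) = 1 \<and> u t \<bullet> e t = 0 \<and> norm (u t) \<le> umax)"

definition can_circumnavigate ::
  "real \<Rightarrow> real \<Rightarrow> real^3 \<Rightarrow> real \<Rightarrow> (real^3) set \<Rightarrow> (real^3) set \<Rightarrow> real \<Rightarrow> real \<Rightarrow> bool" where
  "can_circumnavigate v umax hv a Dout B d0 z \<longleftrightarrow>
     (\<exists>T r e u. 0 < T \<and> admissible_motion v umax T r e u \<and>
        (\<forall>t\<in>{0..T}. r t \<in> Dout \<and> altitude hv a (r t) = z \<and> infdist (r t) (slice hv a B z) = d0) \<and>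
        (\<lambda>t. hnearest hv a B (r t)) ` {0..T} = slice hv a B z)"

end

theory Submission
  imports Defs
begin

text \<open>At a nearest point \<open>b\<close> the robot sits at \<open>b - d\<^sub>0 \<nu>\<close>, where \<open>\<nu>\<close> is the normalised horizontal part of
  \<open>N\<^sub>b\<close>, and moves along \<open>\<plusminus>\<nu> \<times> h\<close>. The sign of the offset is a separation statement: \<open>B\<close> cuts the
  layer, and the robot stays on the side of \<open>D\<^sub>o\<^sub>u\<^sub>t\<close>. With \<open>\<kappa> = \<^bold>I\<^bold>I[T\<^sub>0; T\<^sub>0] / sin \<theta>\<close>, the derivative of \<open>\<nu>\<close>
  along \<open>T\<^sub>0\<close> is \<open>- \<kappa> T\<^sub>0\<close>; so while the nearest point moves by a small \<open>\<delta>\<close>, the robot moves by about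
  \<open>\<bar>1 + \<kappa> d\<^sub>0\<bar> \<delta>\<close> and its orientation turns by about \<open>\<bar>\<kappa>\<bar> \<delta>\<close>. As the turn per unit length is at most
  \<open>1 / R\<close>, and as \<open>1 + \<kappa> d\<^sub>0\<close> cannot be negative at a nearest point, \<open>R \<bar>\<kappa>\<bar> \<le> 1 + \<kappa> d\<^sub>0\<close>.\<close>

section \<open>Local defining functions of smooth domains\<close>

text \<open>The distance is measured to \<open>B\<close> alone, so the segment from \<open>b\<close>
  to the robot may cross other pieces of the boundary of \<open>D\<close>; nearness by itself does
  not show that the robot leaves \<open>b\<close> on the free side. This follows from the layer
  being convex, hence without loops to hide in, and from \<open>Dout\<close> being connected and
  accumulating at every point of \<open>B\<close>.

  The nearest point is only shown to be continuous in time and the orientation to be Lipschitz, so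
  neither is differentiated in time. Increments are divided by the displacement of the nearest point
  instead, and time cancels when turn is compared with path length.

  Points on the top and bottom edges of \<open>B\<close> call for charts that preserve the altitude
  exactly, so that horizontal boundary curves stay in the layer.

  The form of the result comes from dividing by \<bar>\<kappa>\<bar>: since sin \<theta> > 0, the
  term 1 / \<bar>\<kappa>\<bar> is the quotient in the claim and \<kappa> / \<bar>\<kappa>\<bar> is
  the sign of the second fundamental form.\<close>

lemma vec3_inner_expand:
  fixes f :: "real^3 \<Rightarrow> real"
  assumes "linear f"
  shows "f w = (\<chi> i. f (axis i 1)) \<bullet> w"
proof -
  have "f w = f (\<Sum>i\<in>UNIV. w $ i *s axis i 1)"
    by (simp add: basis_expansion)
  also have "\<dots> = (\<Sum>i\<in>UNIV. w $ i * f (axis i 1))"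
    using assms by (simp add: linear_sum linear_cmul scalar_mult_eq_scaleR del: scaleR_conv_of_real)
  finally show ?thesis by (simp add: inner_vec_def mult.commute)
qed

text \<open>\<open>G\<close> is the gradient of \<open>g\<close> and points into \<open>D\<close>
  along the boundary. Its differentiability is the amount of smoothness that lets the unit normal be
  differentiated and so gives a shape operator.\<close>

locale defining_function =
  fixes D U :: "(real^3) set" and g :: "real^3 \<Rightarrow> real" and G :: "real^3 \<Rightarrow> real^3"
  assumes open_U: "open U"
    and g_deriv: "x \<in> U \<Longrightarrow> (g has_derivative (\<lambda>w. G x \<bullet> w)) (at x)"
    and G_diff: "x \<in> U \<Longrightarrow> G differentiable (at x)"
    and G_nz: "x \<in> U \<Longrightarrow> G x \<noteq> 0"
    and mem_iff: "x \<in> U \<Longrightarrow> x \<in> D \<longleftrightarrow> 0 \<le> g x"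

lemma Ck_on_differentiable: "Ck_on k f U \<Longrightarrow> 0 < k \<Longrightarrow> x \<in> U \<Longrightarrow> f differentiable (at x)"
  by (cases k) auto

text \<open>The third coordinate of a straightening chart serves as \<open>g\<close>. Its gradient
  never vanishes because the derivative of the chart has a right inverse, the derivative of the
  inverse chart.\<close>

lemma Ck_domain_defining_function:
  assumes "Ck_domain 3 D" "p \<in> D"
  obtains U g G where "p \<in> U" "defining_function D U g G"
proof -
  obtain U V \<phi> \<psi> where pU: "p \<in> U" and dif: "Ck_diffeo 3 U V \<phi> \<psi>"
    and im: "\<phi> ` (U \<inter> D) = V \<inter> {x. 0 \<le> x $ 3}"
    using assms unfolding Ck_domain_def by blast
  have oU: "open U" "open V" and hom: "homeomorphism U V \<phi> \<psi>"
    and c: "Ck_on 3 \<phi> U" and c2: "Ck_on 3 \<psi> V"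
    using dif by (simp_all add: Ck_diffeo_def)
  have "3 = Suc (Suc 1)" by simp
  with c have c1: "Ck_on (Suc (Suc 1)) \<phi> U" by metis
  define A where "A = (\<lambda>x. frechet_derivative \<phi> (at x))"
  define G where "G = (\<lambda>x. \<chi> i. A x (axis i 1) $ 3)"
  have dA: "(\<phi> has_derivative A x) (at x)" if "x \<in> U" for x
    using c1 that by (auto simp: A_def frechet_derivative_works)
  have dB: "(\<psi> has_derivative frechet_derivative \<psi> (at x)) (at x)" if "x \<in> V" for x
    using Ck_on_differentiable[OF c2] that unfolding frechet_derivative_works[symmetric] by simp
  have linA: "linear (\<lambda>w. A x w $ 3)" if "x \<in> U" for x
    using linear_compose[OF has_derivative_linear[OF dA[OF that]]
        bounded_linear.linear[OF bounded_linear_vec_nth]]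
    by (simp add: o_def)
  have G_eq: "A x w $ 3 = G x \<bullet> w" if "x \<in> U" for x w
    unfolding G_def using vec3_inner_expand[OF linA[OF that], of w] by simp
  have "defining_function D U (\<lambda>x. \<phi> x $ 3) G"
  proof
    show "open U" by fact
  next
    fix x assume x: "x \<in> U"
    have "((\<lambda>x. \<phi> x $ 3) has_derivative (\<lambda>w. A x w $ 3)) (at x)"
      using bounded_linear.has_derivative[OF bounded_linear_vec_nth dA[OF x]] .
    then show "((\<lambda>x. \<phi> x $ 3) has_derivative (\<lambda>w. G x \<bullet> w)) (at x)"
      using G_eq[OF x] by simp
    have "(\<lambda>x. A x w) differentiable (at x)" for w
      using c1 x unfolding A_def by simp
    then have "(\<lambda>x. A x w $ 3) differentiable (at x)" for w
      using bounded_linear.has_derivative[OF bounded_linear_vec_nth] unfolding differentiable_def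
      by blast
    then show "G differentiable (at x)"
      unfolding G_def by (subst differentiable_componentwise_within)
        (auto simp: Basis_vec_def cart_eq_inner_axis[symmetric])
    show "G x \<noteq> 0"
    proof
      assume 0: "G x = 0"
      have y: "\<phi> x \<in> V" "\<psi> (\<phi> x) = x"
        using hom x by (auto simp: homeomorphism_def)
      let ?B = "frechet_derivative \<psi> (at (\<phi> x))"
      have "(\<phi> \<circ> \<psi> has_derivative (A x \<circ> ?B)) (at (\<phi> x))"
        using diff_chain_at[OF dB[OF y(1)]] dA[of x] x y by simp
      moreover have "(\<phi> \<circ> \<psi> has_derivative id) (at (\<phi> x))"
        by (rule has_derivative_transform_within_open[OF has_derivative_id \<open>open V\<close> y(1)])
          (use hom in \<open>auto simp: homeomorphism_def\<close>)
      ultimately have "A x \<circ> ?B = id"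
        by (rule has_derivative_unique)
      then have "A x (?B (axis 3 1)) $ 3 = (axis 3 1 :: real^3) $ 3"
        by (metis comp_apply id_apply)
      then show False
        using G_eq[OF x] 0 by simp
    qed
    show "x \<in> D \<longleftrightarrow> 0 \<le> \<phi> x $ 3"
    proof
      assume "0 \<le> \<phi> x $ 3"
      then have "\<phi> x \<in> \<phi> ` (U \<inter> D)"
        using hom x im by (auto simp: homeomorphism_def)
      then obtain y where y: "y \<in> U" "y \<in> D" "\<phi> x = \<phi> y"
        by blast
      then have "\<psi> (\<phi> x) = \<psi> (\<phi> y)" by simp
      then show "x \<in> D"
        using homeomorphism_apply1[OF hom x] homeomorphism_apply1[OF hom y(1)] y(2) by simp
    qed (use im x in auto)
  qed
  then show thesis using that pU by blast
qed

section \<open>Boundary, tangent plane, normal and shape operator read off a defining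
  function\<close>

context defining_function
begin

lemma g_cont: "x \<in> U \<Longrightarrow> isCont g x"
  using g_deriv has_derivative_continuous by blast

lemma G_cont: "x \<in> U \<Longrightarrow> isCont G x"
  using G_diff differentiable_imp_continuous_within by blast

lemma has_real_derivative_line:
  assumes "x \<in> U"
  shows "((\<lambda>t. g (x + t *\<^sub>R w)) has_real_derivative G x \<bullet> w) (at 0)"
proof -
  have 1: "((\<lambda>t. x + t *\<^sub>R w) has_derivative (\<lambda>t. t *\<^sub>R w)) (at 0)"
    by (auto intro!: derivative_eq_intros)
  have "((\<lambda>t. g (x + t *\<^sub>R w)) has_derivative (\<lambda>t. G x \<bullet> (t *\<^sub>R w))) (at 0)"
    using diff_chain_at[OF 1, of g "\<lambda>w. G x \<bullet> w"] g_deriv[OF assms] by (simp add: o_def)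
  moreover have "(\<lambda>t. G x \<bullet> (t *\<^sub>R w)) = (*) (G x \<bullet> w)"
    by (simp add: fun_eq_iff)
  ultimately show ?thesis
    by (simp add: has_field_derivative_def)
qed

lemma eventually_line_in_U:
  assumes "x \<in> U"
  shows "\<forall>\<^sub>F t in at_right (0::real). x + t *\<^sub>R w \<in> U"
proof -
  have "((\<lambda>t::real. x + t *\<^sub>R w) \<longlongrightarrow> x + 0 *\<^sub>R w) (at_right 0)"
    by (intro tendsto_intros)
  then show ?thesis
    using topological_tendstoD[OF _ open_U] assms by simp
qed

lemma eventually_line_pos:
  assumes "x \<in> U" "g x = 0" "G x \<bullet> w > 0"
  shows "\<forall>\<^sub>F t in at_right (0::real). g (x + t *\<^sub>R w) > 0"
proof -
  have "\<exists>d>0. \<forall>h>0. h < d \<longrightarrow> g (x + 0 *\<^sub>R w) < g (x + (0 + h) *\<^sub>R w)"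
    using DERIV_pos_inc_right[OF has_real_derivative_line[OF assms(1), of w]] assms(3) by auto
  then show ?thesis
    using assms(2) unfolding eventually_at_right_field by auto
qed

lemma eventually_line_neg:
  assumes "x \<in> U" "g x = 0" "G x \<bullet> w < 0"
  shows "\<forall>\<^sub>F t in at_right (0::real). g (x + t *\<^sub>R w) < 0"
proof -
  have "\<exists>d>0. \<forall>h>0. h < d \<longrightarrow> g (x + 0 *\<^sub>R w) > g (x + (0 + h) *\<^sub>R w)"
    using DERIV_neg_dec_right[OF has_real_derivative_line[OF assms(1), of w]] assms(3) by auto
  then show ?thesis
    using assms(2) unfolding eventually_at_right_field by auto
qed

lemma open_superlevel: "open {x\<in>U. 0 < g x}" and open_sublevel: "open {x\<in>U. g x < 0}"
proof -
  have c: "continuous_on U g"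
    using g_cont continuous_at_imp_continuous_on by blast
  have "{x\<in>U. 0 < g x} = U \<inter> g -` {0<..}" "{x\<in>U. g x < 0} = U \<inter> g -` {..<0}" by auto
  then show "open {x\<in>U. 0 < g x}" "open {x\<in>U. g x < 0}"
    using continuous_open_preimage[OF c open_U] by auto
qed

lemma mem_interior_iff:
  assumes "x \<in> U"
  shows "x \<in> interior D \<longleftrightarrow> 0 < g x"
proof
  assume "0 < g x"
  then show "x \<in> interior D"
    using interiorI[OF open_superlevel, of x D] mem_iff assms by force
next
  assume int: "x \<in> interior D"
  then have "0 \<le> g x" using mem_iff assms interior_subset by blast
  moreover have "g x \<noteq> 0"
  proof
    \<comment> \<open>On the zero set, a small step against the gradient leaves \<open>D\<close>, so
      the point cannot be interior.\<close>
    assume 0: "g x = 0"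
    have "G x \<bullet> (- G x) < 0" using G_nz[OF assms] by simp
    from eventually_line_neg[OF assms 0 this] eventually_line_in_U[OF assms, of "- G x"]
    have "\<forall>\<^sub>F t in at_right (0::real). x + t *\<^sub>R (- G x) \<notin> D"
      by eventually_elim (use mem_iff in force)
    moreover have "((\<lambda>t::real. x + t *\<^sub>R (- G x)) \<longlongrightarrow> x + 0 *\<^sub>R (- G x)) (at_right 0)"
      by (intro tendsto_intros)
    then have "\<forall>\<^sub>F t in at_right (0::real). x + t *\<^sub>R (- G x) \<in> interior D"
      using topological_tendstoD[OF _ open_interior] int by simp
    ultimately have "\<forall>\<^sub>F t in at_right (0::real). False"
      by eventually_elim (use interior_subset in blast)
    then show False by simp
  qed
  ultimately show "0 < g x" by simp
qed

lemma mem_frontier_iff: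
  assumes "x \<in> U"
  shows "x \<in> frontier D \<longleftrightarrow> g x = 0"
proof -
  have "x \<in> closure D \<longleftrightarrow> 0 \<le> g x"
  proof
    assume "x \<in> closure D"
    moreover have "{x\<in>U. g x < 0} \<inter> D = {}" using mem_iff by force
    ultimately show "0 \<le> g x"
      using open_Int_closure_eq_empty[OF open_sublevel, of D] assms by force
  qed (use mem_iff assms closure_subset in blast)
  then show ?thesis
    using mem_interior_iff[OF assms] by (auto simp: frontier_def)
qed

text \<open>The local diffeomorphism below, tangent to the identity at \<open>b\<close>, straightens \<open>D\<close> to a
  half-space by moving points along \<open>m\<close> only; it preserves all coordinates orthogonal to \<open>m\<close>.\<close>

lemma straightening:
  assumes "b \<in> U" "g b = 0" "G b \<bullet> m \<noteq> 0"
  obtains W V \<Psi> where "open W" "W \<subseteq> U" "b \<in> W" "open V" "b \<in> V"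
    "homeomorphism W V (\<lambda>x. x + ((g x - G b \<bullet> (x - b)) / (G b \<bullet> m)) *\<^sub>R m) \<Psi>"
    "(\<Psi> has_derivative (\<lambda>w. w)) (at b)"
proof -
  let ?k = "G b \<bullet> m"
  let ?F = "\<lambda>x. x + ((g x - G b \<bullet> (x - b)) / ?k) *\<^sub>R m"
  define F' where "F' = (\<lambda>x. id_blinfun + (1 / ?k) *\<^sub>R
      (blinfun_scaleR_left m o\<^sub>L blinfun_inner_right (G x - G b)))"
  have F'_apply: "F' x w = w + ((G x - G b) \<bullet> w / ?k) *\<^sub>R m" for x w
    by (simp add: F'_def blinfun.add_left blinfun.scaleR_left)
  \<comment> \<open>The numerator \<open>g x - G b \<bullet> (x - b)\<close> of the correction
    vanishes to first order at \<open>b\<close>.\<close>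
  have "F' b = id_blinfun"
    by (rule blinfun_eqI) (simp add: F'_apply)
  then have inv: "id_blinfun o\<^sub>L F' b = id_blinfun"
    by (auto intro: blinfun_eqI)
  have d: "(?F has_derivative F' x) (at x)" if "x \<in> U" for x
    unfolding F'_apply[abs_def]
    using assms(3)
    by (auto intro!: derivative_eq_intros g_deriv[OF that] simp: inner_diff_left)
  have "continuous_on U G"
    using G_cont continuous_at_imp_continuous_on by blast
  then have contF': "continuous_on U F'"
    unfolding F'_def
    by (intro continuous_intros bounded_linear.continuous_on[OF bounded_linear_blinfun_inner_right])
  have Fb: "?F b = b" using assms by simp
  show thesis
  proof (rule inverse_function_theorem[OF open_U _ contF' assms(1) inv])
    show "(?F has_derivative F' x) (at x)" if "x \<in> U" for x
      using d that .
    fix W V \<Psi> \<Psi>'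
    assume *: "open W" "W \<subseteq> U" "b \<in> W" "open V" "?F b \<in> V" "homeomorphism W V ?F \<Psi>"
      and \<Psi>: "\<And>y. y \<in> V \<Longrightarrow> (\<Psi> has_derivative \<Psi>' y) (at y)"
        "\<And>y. y \<in> V \<Longrightarrow> \<Psi>' y = inv (blinfun_apply (F' (\<Psi> y)))"
    have bV: "b \<in> V" using *(5) unfolding Fb .
    have "\<Psi> b = b" using homeomorphism_apply1[OF *(6,3)] unfolding Fb .
    then have "\<Psi>' b = inv (blinfun_apply id_blinfun)"
      using \<Psi>(2)[OF bV] \<open>F' b = id_blinfun\<close> by simp
    also have "blinfun_apply id_blinfun = (id :: real^3 \<Rightarrow> real^3)"
      by (simp add: fun_eq_iff)
    also have "inv id = (\<lambda>w::real^3. w)"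
      by (simp add: id_def)
    finally show thesis
      using that[OF *(1-4) bV *(6)] \<Psi>(1)[OF bV] by simp
  qed
qed

lemma eventually_nhds_in_U:
  assumes "isCont c x" "c x \<in> U"
  shows "\<forall>\<^sub>F t in nhds x. c t \<in> U"
  using topological_tendstoD[OF _ open_U assms(2)] assms(1)
  unfolding isCont_def tendsto_at_iff_tendsto_nhds by blast

text \<open>The inverse map \<open>\<Psi>\<close> carries the affine tangent plane at
  \<open>b\<close> to the zero set of \<open>g\<close>. With \<open>m\<close> horizontal and
  \<open>k\<close> vertical, the preserved coordinate is the altitude.\<close>

lemma straightening_zero:
  assumes "b \<in> U" "g b = 0" "G b \<bullet> m \<noteq> 0"
  obtains W V \<Psi> where "open W" "W \<subseteq> U" "b \<in> W" "open V" "b \<in> V"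
    "\<Psi> ` V = W" "continuous_on V \<Psi>" "\<forall>A. open A \<longrightarrow> A \<subseteq> V \<longrightarrow> open (\<Psi> ` A)" "\<Psi> b = b"
    "\<forall>y\<in>V. g (\<Psi> y) = G b \<bullet> (y - b)"
    "\<forall>y\<in>V. \<forall>k. k \<bullet> m = 0 \<longrightarrow> \<Psi> y \<bullet> k = y \<bullet> k"
    "(\<Psi> has_derivative (\<lambda>w. w)) (at b)"
proof -
  let ?F = "\<lambda>x. x + ((g x - G b \<bullet> (x - b)) / (G b \<bullet> m)) *\<^sub>R m"
  obtain W V \<Psi> where *: "open W" "W \<subseteq> U" "b \<in> W" "open V" "b \<in> V"
    and hom: "homeomorphism W V ?F \<Psi>"
    and d: "(\<Psi> has_derivative (\<lambda>w. w)) (at b)"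
    using straightening[OF assms] .
  have F: "?F (\<Psi> y) = y" if "y \<in> V" for y
    using hom that by (simp add: homeomorphism_def)
  have Fg: "G b \<bullet> (?F x - b) = g x" for x
    using assms(3) by (simp add: inner_diff_right inner_add_right field_simps)
  have Fk: "?F x \<bullet> k = x \<bullet> k" if "k \<bullet> m = 0" for x k
    using that by (simp add: inner_add_left inner_commute[of m k])
  have "?F b = b" using assms by simp
  then have b: "\<Psi> b = b"
    using hom \<open>b \<in> W\<close> by (metis (no_types, lifting) homeomorphism_apply1)
  show thesis
  proof (rule that[OF * _ _ _ b _ _ d])
    show "\<Psi> ` V = W" "continuous_on V \<Psi>"
      using hom by (simp_all add: homeomorphism_def)
    have "open (\<Psi> ` A)" if A: "open A" "A \<subseteq> V" for A
    proof -
      have "openin (top_of_set V) A"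
        using A by (simp add: open_subset)
      with hom have "openin (top_of_set W) (\<Psi> ` A)"
        by (meson homeomorphism_imp_open_map homeomorphism_symD)
      then show "open (\<Psi> ` A)"
        using \<open>open W\<close> openin_open_trans by blast
    qed
    then show "\<forall>A. open A \<longrightarrow> A \<subseteq> V \<longrightarrow> open (\<Psi> ` A)" by blast
    show "\<forall>y\<in>V. g (\<Psi> y) = G b \<bullet> (y - b)"
      using F Fg by metis
    show "\<forall>y\<in>V. \<forall>k. k \<bullet> m = 0 \<longrightarrow> \<Psi> y \<bullet> k = y \<bullet> k"
      using F Fk by metis
  qed
qed

text \<open>The curve is the image of the line \<open>b + t *\<^sub>R V\<close> under
  \<open>\<Psi>\<close>. Coordinates orthogonal to \<open>m\<close> are affine in \<open>t\<close>
  exactly, not just to first order, so a horizontal \<open>V\<close> can give a curve of constant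
  altitude.\<close>

lemma curve_through_frontier:
  assumes "b \<in> U" "b \<in> frontier D" "G b \<bullet> m \<noteq> 0" "G b \<bullet> V = 0"
  obtains c where "curve_through (frontier D) b V c"
    "\<And>k. k \<bullet> m = 0 \<Longrightarrow> \<forall>\<^sub>F t in nhds 0. c t \<bullet> k = b \<bullet> k + t * (V \<bullet> k)"
proof -
  obtain W Y \<Psi> where Y: "open W" "W \<subseteq> U" "b \<in> W" "open Y" "b \<in> Y"
    "\<Psi> ` Y = W" "continuous_on Y \<Psi>" and op: "\<forall>A. open A \<longrightarrow> A \<subseteq> Y \<longrightarrow> open (\<Psi> ` A)"
    and b: "\<Psi> b = b"
    and g\<Psi>: "\<forall>y\<in>Y. g (\<Psi> y) = G b \<bullet> (y - b)"
    and k\<Psi>: "\<forall>y\<in>Y. \<forall>k. k \<bullet> m = 0 \<longrightarrow> \<Psi> y \<bullet> k = y \<bullet> k"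
    and d: "(\<Psi> has_derivative (\<lambda>w. w)) (at b)"
    by (rule straightening_zero[OF assms(1) mem_frontier_iff[THEN iffD1, OF assms(1,2)] assms(3)])
  let ?l = "\<lambda>t::real. b + t *\<^sub>R V"
  have "((\<lambda>t. ?l t) \<longlongrightarrow> b + 0 *\<^sub>R V) (nhds 0)"
    by (intro tendsto_intros filterlim_ident)
  then have ev: "\<forall>\<^sub>F t in nhds 0. ?l t \<in> Y"
    using topological_tendstoD Y by fastforce
  have dl: "(?l has_derivative (\<lambda>t. t *\<^sub>R V)) (at 0)"
    by (auto intro!: derivative_eq_intros)
  have "(\<Psi> \<circ> ?l has_derivative (\<lambda>w. w) \<circ> (\<lambda>t. t *\<^sub>R V)) (at 0)"
    by (rule diff_chain_at[OF dl]) (use d in simp)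
  then have dc: "((\<lambda>t. \<Psi> (?l t)) has_vector_derivative V) (at 0)"
    by (simp add: o_def has_vector_derivative_def)
  show thesis
  proof
    have "\<forall>\<^sub>F t in nhds 0. \<Psi> (?l t) \<in> frontier D"
      using ev
    proof eventually_elim
      case (elim t)
      then have "\<Psi> (?l t) \<in> U" using Y by blast
      moreover have "g (\<Psi> (?l t)) = 0"
        using bspec[OF g\<Psi> elim] assms(4) by simp
      ultimately show ?case using mem_frontier_iff by blast
    qed
    then show "curve_through (frontier D) b V (\<lambda>t. \<Psi> (?l t))"
      using dc b by (simp add: curve_through_def)
    fix k assume "k \<bullet> m = 0"
    then show "\<forall>\<^sub>F t in nhds 0. \<Psi> (?l t) \<bullet> k = b \<bullet> k + t * (V \<bullet> k)"
      using eventually_mono[OF ev] k\<Psi> by (simp add: inner_add_left)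
  qed
qed

text \<open>In straightened coordinates the piece is a ball cut by a plane and a slab, which is
  convex. This local connectedness will make \<open>B\<close> relatively open in the boundary within
  the layer.\<close>

lemma connected_frontier_slab:
  assumes "b \<in> U" "b \<in> frontier D" "G b \<bullet> m \<noteq> 0" "k \<bullet> m = 0"
  obtains W where "open W" "b \<in> W" "connected (W \<inter> (frontier D \<inter> {x. x \<bullet> k \<in> {l..u}}))"
proof -
  obtain W Y \<Psi> where Y: "open W" "W \<subseteq> U" "b \<in> W" "open Y" "b \<in> Y"
    "\<Psi> ` Y = W" "continuous_on Y \<Psi>" and op: "\<forall>A. open A \<longrightarrow> A \<subseteq> Y \<longrightarrow> open (\<Psi> ` A)"
    and b: "\<Psi> b = b"
    and g\<Psi>: "\<forall>y\<in>Y. g (\<Psi> y) = G b \<bullet> (y - b)"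
    and k\<Psi>: "\<forall>y\<in>Y. \<forall>k. k \<bullet> m = 0 \<longrightarrow> \<Psi> y \<bullet> k = y \<bullet> k"
    and d: "(\<Psi> has_derivative (\<lambda>w. w)) (at b)"
    by (rule straightening_zero[OF assms(1) mem_frontier_iff[THEN iffD1, OF assms(1,2)] assms(3)])
  obtain e where e: "e > 0" "ball b e \<subseteq> Y"
    using Y openE by blast
  let ?C = "ball b e \<inter> {y. G b \<bullet> y = G b \<bullet> b} \<inter> {y. k \<bullet> y \<ge> l} \<inter> {y. k \<bullet> y \<le> u}"
  have C: "convex ?C"
    by (intro convex_Int convex_ball convex_hyperplane convex_halfspace_ge convex_halfspace_le)
  have "\<Psi> ` ball b e \<inter> (frontier D \<inter> {x. x \<bullet> k \<in> {l..u}}) = \<Psi> ` ?C"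
  proof (intro set_eqI iffI)
    fix x assume "x \<in> \<Psi> ` ball b e \<inter> (frontier D \<inter> {x. x \<bullet> k \<in> {l..u}})"
    then obtain y where y: "x = \<Psi> y" "y \<in> ball b e" and x: "x \<in> frontier D" "x \<bullet> k \<in> {l..u}"
      by blast
    have "y \<in> Y" using y e by blast
    then have "x \<in> U" using y Y by blast
    then have "g x = 0" using mem_frontier_iff x by blast
    then have "G b \<bullet> y = G b \<bullet> b"
      using bspec[OF g\<Psi> \<open>y \<in> Y\<close>] y by (simp add: inner_diff_right)
    moreover have "k \<bullet> y = x \<bullet> k"
      using bspec[OF k\<Psi> \<open>y \<in> Y\<close>, rule_format, OF assms(4)] y by (simp add: inner_commute)
    ultimately show "x \<in> \<Psi> ` ?C" using y x by auto
  next
    fix x assume "x \<in> \<Psi> ` ?C"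
    then obtain y where y: "x = \<Psi> y" "y \<in> ?C" by blast
    then have "y \<in> Y" using e by blast
    then have "x \<in> U" using y Y by blast
    moreover have "g x = 0"
      using bspec[OF g\<Psi> \<open>y \<in> Y\<close>] y by (simp add: inner_diff_right)
    moreover have "k \<bullet> y = x \<bullet> k"
      using bspec[OF k\<Psi> \<open>y \<in> Y\<close>, rule_format, OF assms(4)] y by (simp add: inner_commute)
    ultimately show "x \<in> \<Psi> ` ball b e \<inter> (frontier D \<inter> {x. x \<bullet> k \<in> {l..u}})"
      using y mem_frontier_iff by auto
  qed
  moreover have "continuous_on ?C \<Psi>"
    by (rule continuous_on_subset[OF Y(7)]) (use e in blast)
  then have "connected (\<Psi> ` ?C)"
    using C convex_connected connected_continuous_image by blast
  moreover have "b \<in> \<Psi> ` ball b e"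
    using b e by (metis centre_in_ball imageI)
  ultimately show thesis
    using that[OF op[rule_format, OF open_ball e(2)]] by simp
qed

lemma tangent_space_frontier:
  assumes "b \<in> U" "b \<in> frontier D"
  shows "tangent_space (frontier D) b = {V. G b \<bullet> V = 0}"
proof (intro set_eqI iffI)
  fix V assume "V \<in> tangent_space (frontier D) b"
  then obtain c where c: "c 0 = b" "(c has_vector_derivative V) (at 0)"
    "\<forall>\<^sub>F t in nhds 0. c t \<in> frontier D"
    by (auto simp: tangent_space_def curve_through_def)
  have "isCont c 0"
    using c(2) has_vector_derivative_continuous by blast
  then have "\<forall>\<^sub>F t in nhds 0. c t \<in> U"
    using eventually_nhds_in_U[of 0 c] c(1) assms(1) by simp
  with c(3) have ev: "\<forall>\<^sub>F t in nhds 0. g (c t) = 0"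
    by eventually_elim (use mem_frontier_iff in blast)
  have "(g \<circ> c has_derivative (\<lambda>w. G b \<bullet> w) \<circ> (\<lambda>t. t *\<^sub>R V)) (at 0)"
    by (rule diff_chain_at) (use c g_deriv assms in \<open>auto simp: has_vector_derivative_def\<close>)
  moreover have "(\<lambda>w. G b \<bullet> w) \<circ> (\<lambda>t. t *\<^sub>R V) = (*) (G b \<bullet> V)"
    by (simp add: fun_eq_iff)
  ultimately have "((\<lambda>t. g (c t)) has_real_derivative G b \<bullet> V) (at 0)"
    by (simp add: o_def has_field_derivative_def)
  moreover have "((\<lambda>t. g (c t)) has_real_derivative 0) (at 0)"
    using DERIV_cong_ev[OF refl ev refl] by simp
  ultimately show "V \<in> {V. G b \<bullet> V = 0}"
    using DERIV_unique by blast
next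
  fix V assume "V \<in> {V. G b \<bullet> V = 0}"
  moreover have "G b \<bullet> G b \<noteq> 0" using G_nz assms by simp
  ultimately show "V \<in> tangent_space (frontier D) b"
    using curve_through_frontier[OF assms] unfolding tangent_space_def by blast
qed

lemma inward_normal_eq:
  assumes "b \<in> U" "b \<in> frontier D"
  shows "inward_normal D b = G b /\<^sub>R norm (G b)"
  unfolding inward_normal_def
proof (rule the_equality)
  let ?n = "G b /\<^sub>R norm (G b)"
  have G: "G b \<noteq> 0" and gb: "g b = 0"
    using G_nz mem_frontier_iff assms by blast+
  have pos: "\<forall>\<^sub>F t in at_right 0. b + t *\<^sub>R w \<in> interior D" if "G b \<bullet> w > 0" for w
    using eventually_line_pos[OF assms(1) gb that] eventually_line_in_U[OF assms(1), of w]
    by eventually_elim (use mem_interior_iff in blast)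
  show "norm ?n = 1 \<and> (\<forall>V\<in>tangent_space (frontier D) b. orthogonal ?n V) \<and>
     (\<forall>\<^sub>F t in at_right 0. b + t *\<^sub>R ?n \<in> interior D)"
    using pos[of ?n] G by (simp add: tangent_space_frontier[OF assms] orthogonal_def del: scaleR_scaleR)
  fix n assume n: "norm n = 1 \<and> (\<forall>V\<in>tangent_space (frontier D) b. orthogonal n V) \<and>
     (\<forall>\<^sub>F t in at_right 0. b + t *\<^sub>R n \<in> interior D)"
  \<comment> \<open>The part of \<open>n\<close> orthogonal to \<open>G b\<close> is tangent, hence
    orthogonal to \<open>n\<close> as well, and must vanish. The ray condition then decides the sign
    of \<open>k\<close>.\<close>
  define k where "k = (G b \<bullet> n) / (G b \<bullet> G b)"
  let ?V = "n - k *\<^sub>R G b"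
  have "G b \<bullet> ?V = 0"
    using G by (simp add: k_def inner_diff_right)
  moreover from this have "n \<bullet> ?V = 0"
    using n tangent_space_frontier[OF assms] by (auto simp: orthogonal_def)
  ultimately have "?V \<bullet> ?V = 0"
    by (simp add: inner_diff_left)
  then have nk: "n = k *\<^sub>R G b" by simp
  have "\<not> k < 0"
  proof
    assume "k < 0"
    then have "G b \<bullet> n < 0" using nk G by (simp add: mult_neg_pos)
    from eventually_line_neg[OF assms(1) gb this] eventually_line_in_U[OF assms(1), of n]
      n[THEN conjunct2, THEN conjunct2]
    have "\<forall>\<^sub>F t in at_right (0::real). False"
      by eventually_elim (use mem_interior_iff in force)
    then show False by simp
  qed
  moreover have "\<bar>k\<bar> * norm (G b) = 1" using n nk by (metis norm_scaleR)
  ultimately have "k = inverse (norm (G b))"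
    using G by (simp add: field_simps)
  then show "n = ?n" using nk by simp
qed

text \<open>The normalised gradient extends the normal field to a neighbourhood, so all curves with
  velocity \<open>V\<close> yield the same derivative. The definite description also needs one such
  curve to exist; otherwise every vector would qualify.\<close>

lemma shape_op_eq:
  assumes "b \<in> U" "b \<in> frontier D" "G b \<bullet> V = 0"
    and N': "((\<lambda>x. G x /\<^sub>R norm (G x)) has_derivative N') (at b)"
  shows "shape_op D b V = - N' V"
proof -
  have der: "((\<lambda>t. inward_normal D (c t)) has_vector_derivative N' V) (at 0)"
    if c: "curve_through (frontier D) b V c" for c
  proof -
    have c: "c 0 = b" "(c has_vector_derivative V) (at 0)" "\<forall>\<^sub>F t in nhds 0. c t \<in> frontier D"
      using c by (auto simp: curve_through_def)
    have "isCont c 0"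
      using c(2) has_vector_derivative_continuous by blast
    then have "\<forall>\<^sub>F t in nhds 0. c t \<in> U"
      using eventually_nhds_in_U[of 0 c] c(1) assms(1) by simp
    with c(3) have ev: "\<forall>\<^sub>F t in nhds 0. G (c t) /\<^sub>R norm (G (c t)) = inward_normal D (c t)"
      by eventually_elim (use inward_normal_eq in simp)
    have "((\<lambda>x. G x /\<^sub>R norm (G x)) \<circ> c has_derivative N' \<circ> (\<lambda>t. t *\<^sub>R V)) (at 0)"
      by (rule diff_chain_at) (use c N' in \<open>auto simp: has_vector_derivative_def\<close>)
    then have "((\<lambda>t. G (c t) /\<^sub>R norm (G (c t))) has_vector_derivative N' V) (at 0)"
      using linear_cmul[OF has_derivative_linear[OF N']]
      by (simp add: o_def has_vector_derivative_def)
    moreover obtain S where "open S" "0 \<in> S"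
      "\<And>t. t \<in> S \<Longrightarrow> G (c t) /\<^sub>R norm (G (c t)) = inward_normal D (c t)"
      using ev by (auto simp: eventually_nhds)
    ultimately show ?thesis
      by (rule has_vector_derivative_transform_within_open)
  qed
  have "surface_deriv (frontier D) (inward_normal D) b V = N' V"
    unfolding surface_deriv_def
  proof (rule the_equality)
    show "\<forall>c. curve_through (frontier D) b V c \<longrightarrow>
      ((\<lambda>t. inward_normal D (c t)) has_vector_derivative N' V) (at 0)"
      using der by blast
    fix X assume X: "\<forall>c. curve_through (frontier D) b V c \<longrightarrow>
      ((\<lambda>t. inward_normal D (c t)) has_vector_derivative X) (at 0)"
    obtain c where "curve_through (frontier D) b V c"
      using tangent_space_frontier[OF assms(1,2)] assms(3) by (auto simp: tangent_space_def)
    then show "X = N' V"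
      using X der vector_derivative_unique_at by blast
  qed
  then show ?thesis by (simp add: shape_op_def)
qed

text \<open>Differentiating the normalising factor contributes only a multiple of
  \<open>G b\<close>, which is orthogonal to \<open>V\<close>.\<close>

lemma second_ff_eq:
  assumes "b \<in> U" "b \<in> frontier D" "G b \<bullet> V = 0" "(G has_derivative G') (at b)"
  shows "second_ff D b V V = - (G' V \<bullet> V) / norm (G b)"
proof -
  have G: "G b \<noteq> 0" using G_nz assms by blast
  have "norm differentiable (at (G b))"
    using G differentiable_norm_at by blast
  then have "(\<lambda>x. norm (G x)) differentiable (at b)"
    using assms(4) differentiable_chain_at[of G b norm] by (auto simp: differentiable_def o_def)
  then have "(\<lambda>x. inverse (norm (G x))) differentiable (at b)"
    using G by (simp add: differentiable_inverse)
  then obtain q where q: "((\<lambda>x. inverse (norm (G x))) has_derivative q) (at b)"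
    by (auto simp: differentiable_def)
  have "shape_op D b V = - (inverse (norm (G b)) *\<^sub>R G' V + q V *\<^sub>R G b)"
    by (rule shape_op_eq[OF assms(1-3) has_derivative_scaleR[OF q assms(4)]])
  then show ?thesis
    using assms(3) by (simp add: second_ff_def inner_add_left inner_diff_left divide_inverse)
qed

end

section \<open>The side of a separating surface\<close>

text \<open>\<open>D\<close> goes to the upper half of the unit circle, its complement to the lower
  half. The sign jumps on the frontier of \<open>D\<close>, but within \<open>L\<close> the sine is
  zero there: \<open>c\<close> is 0 on \<open>B\<close> and 1 on all other frontier points.\<close>

lemma continuous_winding_map:
  fixes B D :: "'a::euclidean_space set"
  assumes "closed D" "0 < \<eta>" "B \<noteq> {}"
    and far: "\<And>x. x \<in> K - B \<Longrightarrow> \<eta> \<le> infdist x B"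
    and K: "frontier D \<inter> L \<subseteq> K"
  defines "c \<equiv> \<lambda>x. min 1 (infdist x B / \<eta>)"
  shows "continuous_on L (\<lambda>x. cis ((if x \<in> D then 1 else -1) * pi * c x))"
proof -
  define s where "s = (\<lambda>x. if x \<in> D then 1 else -1 :: real)"
  have c: "isCont c x" for x
    unfolding c_def using \<open>0 < \<eta>\<close> by (intro continuous_intros) auto
  then have sinc: "isCont (\<lambda>x. sin (pi * c x)) x" for x
    by (intro continuous_intros)
  have Im: "isCont (\<lambda>x. s x * sin (pi * c x)) x" if x: "x \<in> L" for x
  proof (cases "x \<in> frontier D")
    case True
    have "sin (pi * c x) = 0"
    proof (cases "x \<in> B")
      case True
      then show ?thesis by (simp add: c_def)
    next
      case False
      then have "\<eta> \<le> infdist x B" using far K x True by blast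
      then show ?thesis using \<open>0 < \<eta>\<close> by (simp add: c_def)
    qed
    moreover have "((\<lambda>x. s x * sin (pi * c x)) \<longlongrightarrow> 0) (at x)"
    proof (rule Lim_null_comparison)
      show "\<forall>\<^sub>F y in at x. norm (s y * sin (pi * c y)) \<le> \<bar>sin (pi * c y)\<bar>"
        by (simp add: s_def abs_mult)
      show "((\<lambda>y. \<bar>sin (pi * c y)\<bar>) \<longlongrightarrow> 0) (at x)"
        using sinc[of x] \<open>sin (pi * c x) = 0\<close> by (auto simp: isCont_def intro: tendsto_rabs_zero)
    qed
    ultimately show ?thesis by (simp add: isCont_def)
  next
    case False
    then have "x \<in> interior D \<or> x \<in> - D"
      using \<open>closed D\<close> by (auto simp: frontier_def)
    moreover have "open (- D)" using \<open>closed D\<close> by auto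
    ultimately have "\<forall>\<^sub>F y in nhds x. s y = s x"
      using eventually_nhds_in_open[OF open_interior, of x D] eventually_nhds_in_open[of "- D" x]
        interior_subset[of D]
      by (auto simp: s_def elim!: eventually_mono)
    then have "\<forall>\<^sub>F y in nhds x. s y * sin (pi * c y) = s x * sin (pi * c y)"
      by eventually_elim simp
    moreover have "isCont (\<lambda>y. s x * sin (pi * c y)) x"
      using c by (intro continuous_intros)
    ultimately show ?thesis
      by (subst isCont_cong)
  qed
  have "cis ((if x \<in> D then 1 else -1) * pi * c x) = Complex (cos (pi * c x)) (s x * sin (pi * c x))" for x
    by (simp add: s_def complex_eq_iff)
  moreover have "continuous_on L (\<lambda>x. Complex (cos (pi * c x)) (s x * sin (pi * c x)))"
  proof (intro continuous_on_Complex)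
    show "continuous_on L (\<lambda>x. cos (pi * c x))"
      using c by (intro continuous_intros continuous_at_imp_continuous_on ballI)
    show "continuous_on L (\<lambda>x. s x * sin (pi * c x))"
      using Im by (intro continuous_at_imp_continuous_on ballI)
  qed
  ultimately show ?thesis by simp
qed

text \<open>If the segment started into \<open>D\<close>, it would close up, through \<open>E\<close>, to a loop in the convex set
  \<open>L\<close> that crosses \<open>B\<close> exactly once. The crossing number is read off a logarithm of the circle-valued
  map of the previous lemma, which is \<open>1\<close> exactly on \<open>B\<close> and \<open>-1\<close> off a collar of \<open>B\<close>.\<close>

lemma segment_leaves_outside:
  fixes B D L E :: "'a::euclidean_space set"
  assumes "closed D" "closed L" "convex L" "compact B"
    and B: "openin (top_of_set (frontier D \<inter> L)) B"
    and E: "connected E" "E \<subseteq> L - D" "b \<in> closure E"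
    and "b \<in> B" "p \<in> E"
    and seg: "\<And>t. 0 < t \<Longrightarrow> t \<le> 1 \<Longrightarrow> b + t *\<^sub>R (p - b) \<notin> B"
  shows "\<not> (\<forall>\<^sub>F t in at_right 0. b + t *\<^sub>R (p - b) \<in> D)"
proof
  assume ray: "\<forall>\<^sub>F t in at_right 0. b + t *\<^sub>R (p - b) \<in> D"
  let ?K = "frontier D \<inter> L"
  have "closed ?K" using \<open>closed L\<close> by auto
  moreover have "closedin (top_of_set ?K) (?K - B)"
    using B openin_imp_subset[OF B] by (auto simp: closedin_def double_diff)
  ultimately have "closed (?K - B)"
    using closedin_closed_trans by blast
  \<comment> \<open>\<open>\<eta>\<close> is the width of the collar: \<open>B\<close> is compact,
    and the rest of the frontier in \<open>L\<close> is closed because \<open>B\<close> is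
    relatively open.\<close>
  then obtain \<eta> where \<eta>: "\<eta> > 0" "\<And>x y. x \<in> B \<Longrightarrow> y \<in> ?K - B \<Longrightarrow> \<eta> \<le> dist x y"
    using separate_compact_closed[OF \<open>compact B\<close>, of "?K - B"] by auto
  have Bne: "B \<noteq> {}" using \<open>b \<in> B\<close> by blast
  have BK: "B \<subseteq> ?K" using B openin_imp_subset by blast
  then have bL: "b \<in> L" and BD: "B \<subseteq> D"
    using \<open>b \<in> B\<close> \<open>closed D\<close> frontier_subset_closed by auto
  have far: "\<eta> \<le> infdist x B" if "x \<in> ?K - B" for x
    using Bne \<eta>(2)[OF _ that] by (simp add: infdist_notempty dist_commute cINF_greatest)
  define c where "c = (\<lambda>x. min 1 (infdist x B / \<eta>))"
  define F where "F = (\<lambda>x. cis ((if x \<in> D then 1 else -1) * pi * c x))"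
  have "continuous_on L F"
    unfolding F_def c_def using continuous_winding_map[OF \<open>closed D\<close> \<eta>(1) Bne far] by blast
  moreover have "F x \<noteq> 0" for x by (simp add: F_def)
  ultimately obtain q where q: "continuous_on L q" "\<And>x. x \<in> L \<Longrightarrow> F x = exp (q x)"
    using continuous_logarithm_on_contractible[OF _ convex_imp_contractible[OF \<open>convex L\<close>], of F]
    by metis
  \<comment> \<open>\<open>\<phi>\<close> counts the turns of \<open>F\<close>. The logarithm is
    global because the convex set \<open>L\<close> is contractible.\<close>
  define \<phi> where "\<phi> = (\<lambda>x. Im (q x) / (2 * pi))"
  have cont\<phi>: "continuous_on L \<phi>"
    unfolding \<phi>_def using q(1) by (intro continuous_intros) auto
  have contc: "continuous_on A c" for A
    unfolding c_def using \<eta>(1) by (intro continuous_intros) auto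
  have F\<phi>: "F x = cis (2 * pi * \<phi> x)" if "x \<in> L" for x
  proof -
    have "norm (F x) = 1" by (simp add: F_def)
    then have "norm (exp (q x)) = 1" using q(2)[OF that] by metis
    then have "exp (q x) = cis (Im (q x))"
      by (simp add: exp_eq_polar norm_mult)
    then show ?thesis using q(2)[OF that] by (simp add: \<phi>_def)
  qed
  have c01: "0 \<le> c x" "c x \<le> 1" for x
    using \<eta>(1) by (auto simp: c_def infdist_nonneg)
  have c0: "c x = 0 \<longleftrightarrow> x \<in> B" for x
    using \<eta>(1) in_closed_iff_infdist_zero[OF compact_imp_closed[OF \<open>compact B\<close>] Bne, of x]
    by (auto simp: c_def min_def)
  have cis_eq: "(x - y) / (2 * pi) \<in> \<int>" if "cis x = cis y" for x y
  proof -
    have "cos (x - y) = 1"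
      using that by (simp add: cos_diff complex_eq_iff flip: power2_eq_square)
    then obtain n :: int where "x - y = n * 2 * pi"
      by (auto simp: cos_one_2pi_int)
    then show ?thesis by simp
  qed
  have avoid: "\<phi> x \<notin> \<int>" if "x \<in> L" "x \<notin> B" for x
  proof
    assume "\<phi> x \<in> \<int>"
    then have "F x = 1" using F\<phi>[OF that(1)] cis_multiple_2pi[of "\<phi> x"] by simp
    then have "cos (pi * c x) = 1"
      by (auto simp: F_def complex_eq_iff split: if_splits)
    moreover have "0 < pi * c x" "pi * c x \<le> pi"
      using c01[of x] c0[of x] that(2) by (auto simp: less_le mult_le_cancel_left1)
    ultimately show False
      using cos_monotone_0_pi[of 0 "pi * c x"] by simp
  qed
  \<comment> \<open>Modulo integers, \<open>\<phi>\<close> is \<open>- c / 2\<close> outside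
    \<open>D\<close> and \<open>c / 2\<close> inside, so passing through \<open>B\<close> into
    \<open>D\<close> raises \<open>\<phi>\<close> through an integer.\<close>
  have outside: "\<phi> x + c x / 2 \<in> \<int>" if "x \<in> L" "x \<notin> D" for x
  proof -
    have "(2 * pi * \<phi> x - (- pi * c x)) / (2 * pi) \<in> \<int>"
      using F\<phi>[OF that(1)] that(2) by (intro cis_eq) (simp add: F_def)
    moreover have "(2 * pi * \<phi> x - (- pi * c x)) / (2 * pi) = \<phi> x + c x / 2"
      by (simp add: add_divide_distrib)
    ultimately show ?thesis by simp
  qed
  have inside: "\<phi> x - c x / 2 \<in> \<int>" if "x \<in> L" "x \<in> D" for x
  proof -
    have "(2 * pi * \<phi> x - pi * c x) / (2 * pi) \<in> \<int>"
      using F\<phi>[OF that(1)] that(2) by (intro cis_eq) (simp add: F_def)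
    moreover have "(2 * pi * \<phi> x - pi * c x) / (2 * pi) = \<phi> x - c x / 2"
      by (simp add: diff_divide_distrib)
    ultimately show ?thesis by simp
  qed
  have Ints_dist: "1 \<le> \<bar>x - y\<bar>" if "x \<in> \<int>" "y \<in> \<int>" "x \<noteq> y" for x y :: real
    using that by (meson Ints_diff Ints_nonzero_abs_ge1 right_minus_eq)
  have contE: "continuous_on L (\<lambda>x. \<phi> x + c x / 2)"
    using cont\<phi> contc by (intro continuous_intros) auto
  have EL: "E \<subseteq> L" and ED: "\<And>x. x \<in> E \<Longrightarrow> x \<notin> D" using E by auto
  \<comment> \<open>An integer-valued continuous function on a connected set is constant. The value
    \<open>k\<close> is inherited by the limit point \<open>b\<close>, where \<open>c\<close> is 0;
    this ties the lift at \<open>p\<close> to the lift at \<open>b\<close>.\<close>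
  have "(\<lambda>x. \<phi> x + c x / 2) constant_on E"
  proof (rule continuous_discrete_range_constant[OF E(1)])
    show "continuous_on E (\<lambda>x. \<phi> x + c x / 2)"
      using continuous_on_subset[OF contE EL] .
    fix x assume "x \<in> E"
    then show "\<exists>e>0. \<forall>y. y \<in> E \<and> \<phi> y + c y / 2 \<noteq> \<phi> x + c x / 2 \<longrightarrow>
        e \<le> norm (\<phi> y + c y / 2 - (\<phi> x + c x / 2))"
      using Ints_dist outside EL ED by (intro exI[of _ 1]) (auto simp: subset_iff)
  qed
  then obtain k where k: "\<And>x. x \<in> E \<Longrightarrow> \<phi> x + c x / 2 = k"
    by (auto simp: constant_on_def)
  have "closed {x \<in> L. \<phi> x + c x / 2 = k}"
    using continuous_closed_preimage_constant[OF contE \<open>closed L\<close>] .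
  moreover have "E \<subseteq> {x \<in> L. \<phi> x + c x / 2 = k}" using k EL by blast
  ultimately have "b \<in> {x \<in> L. \<phi> x + c x / 2 = k}"
    using E(3) closure_minimal by blast
  then have \<phi>b: "\<phi> b = k" using c0[of b] \<open>b \<in> B\<close> by simp
  have pL: "p \<in> L" and pD: "p \<notin> D" using \<open>p \<in> E\<close> EL ED by auto
  have k_Int: "k \<in> \<int>" using k[OF \<open>p \<in> E\<close>] outside[OF pL pD] by simp
  have "c p > 0" using c0[of p] c01[of p] pD BD by (auto simp: less_le)
  then have \<phi>p: "\<phi> p < k" using k[OF \<open>p \<in> E\<close>] by simp
  let ?x = "\<lambda>t::real. b + t *\<^sub>R (p - b)"
  have xL: "?x t \<in> L" if "0 \<le> t" "t \<le> 1" for t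
  proof -
    have "?x t = (1 - t) *\<^sub>R b + t *\<^sub>R p" by (simp add: algebra_simps)
    then show ?thesis using convexD_alt[OF \<open>convex L\<close> bL pL] that by simp
  qed
  have cont_x: "continuous_on {0..1} (\<lambda>t. \<phi> (?x t))"
    by (rule continuous_on_compose2[OF cont\<phi>]) (auto intro!: continuous_intros xL)
  moreover have "continuous_on {0..1} (\<lambda>t. c (?x t))"
    by (rule continuous_on_compose2[OF contc[of UNIV]]) (auto intro!: continuous_intros)
  ultimately have "continuous_on {0..1} (\<lambda>t. \<phi> (?x t) - c (?x t) / 2)"
    by (intro continuous_intros) auto
  then have "((\<lambda>t. \<phi> (?x t) - c (?x t) / 2) \<longlongrightarrow> \<phi> (?x 0) - c (?x 0) / 2) (at 0 within {0..1})"
    unfolding continuous_on_def by (rule bspec) simp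
  then have "((\<lambda>t. \<phi> (?x t) - c (?x t) / 2) \<longlongrightarrow> k) (at_right 0)"
    using c0[of b] \<open>b \<in> B\<close> \<phi>b at_within_Icc_at_right[of 0 "1::real"] by simp
  then have "\<forall>\<^sub>F t in at_right 0. dist (\<phi> (?x t) - c (?x t) / 2) k < 1"
    by (rule tendstoD) simp
  moreover have "\<forall>\<^sub>F t in at_right (0::real). 0 < t \<and> t < 1"
    using eventually_at_right_less[of "0::real"] eventually_at_right_real[of 0 "1::real"] by (auto elim: eventually_mono)
  \<comment> \<open>Just after \<open>b\<close> the segment is in \<open>D\<close> and off
    \<open>B\<close>. There the integer \<open>\<phi> - c / 2\<close> is close to \<open>k\<close>,
    hence equal to it, and \<open>\<phi>\<close> exceeds \<open>k\<close>.\<close>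
  ultimately have "\<forall>\<^sub>F t in at_right 0. 0 < t \<and> t < 1 \<and> \<phi> (?x t) > k"
    using ray
  proof eventually_elim
    case (elim t)
    then have "?x t \<in> L" using xL by simp
    then have "\<phi> (?x t) - c (?x t) / 2 \<in> \<int>" using inside elim by blast
    then have "\<phi> (?x t) - c (?x t) / 2 = k"
      using Ints_dist[OF _ k_Int] elim(1) by (force simp: dist_real_def)
    moreover have "c (?x t) > 0"
      using c0[of "?x t"] c01[of "?x t"] seg[of t] elim by (auto simp: less_le)
    ultimately show ?case using elim by simp
  qed
  then obtain t where t: "0 < t" "t < 1" "\<phi> (?x t) > k"
    using eventually_happens'[of "at_right (0::real)"] by (auto simp: trivial_limit_at_right_real)
  \<comment> \<open>As \<open>\<phi>\<close> is below \<open>k\<close> at \<open>p\<close>, it meets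
    the integer \<open>k\<close> again at a point of the segment off \<open>B\<close>, contrary to
    \<open>avoid\<close>.\<close>
  have "\<exists>s\<ge>t. s \<le> 1 \<and> \<phi> (?x s) = k"
    using t \<phi>p continuous_on_subset[OF cont_x, of "{t..1}"]
    by (intro IVT2') (auto simp: algebra_simps)
  then obtain s where s: "t \<le> s" "s \<le> 1" "\<phi> (?x s) = k" by blast
  then show False
    using avoid[OF xL[of s]] seg[of s] t k_Int by simp
qed

section \<open>The turning bound\<close>

text \<open>The directions \<open>sgn (\<beta> s - b)\<close> need not converge, so the normalised
  increment is compared with the derivative in the current direction instead of a limit
  direction.\<close>

lemma has_derivative_tendsto_quotient:
  assumes "(f has_derivative f') (at b)" "filterlim \<beta> (at b) F"
  shows "((\<lambda>s. (f (\<beta> s) - f b) /\<^sub>R norm (\<beta> s - b) - f' (sgn (\<beta> s - b))) \<longlongrightarrow> 0) F"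
proof -
  have lin: "linear f'" using assms(1) by (rule has_derivative_linear)
  have "((\<lambda>y. (f y - f b - f' (y - b)) /\<^sub>R norm (y - b)) \<longlongrightarrow> 0) (at b)"
    using assms(1) unfolding has_derivative_at_within by blast
  from filterlim_compose[OF this assms(2)] show ?thesis
    unfolding sgn_div_norm linear_cmul[OF lin] by (simp add: scaleR_diff_right)
qed

lemma bounded_linear_cross_left: "bounded_linear (\<lambda>x. cross3 x h)"
  by (auto intro!: linear_conv_bounded_linear[THEN iffD1] linearI simp: cross_add_left cross_mult_left)

lemma norm_cross_orthogonal:
  assumes "norm h = 1" "x \<bullet> h = 0"
  shows "norm (cross3 x h) = norm x"
  using norm_cross[of x h] assms by simp

text \<open>The remainder \<open>y\<close> is orthogonal to \<open>n\<close> and \<open>h\<close>,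
  so Lagrange's identity makes it parallel to \<open>cross3 n h\<close>.\<close>

lemma orthonormal_frame_expansion:
  fixes n h x :: "real^3"
  assumes "norm n = 1" "norm h = 1" "n \<bullet> h = 0"
  shows "x = (x \<bullet> cross3 n h) *\<^sub>R cross3 n h + (x \<bullet> n) *\<^sub>R n + (x \<bullet> h) *\<^sub>R h"
proof -
  let ?T = "cross3 n h"
  define y where "y = x - (x \<bullet> n) *\<^sub>R n - (x \<bullet> h) *\<^sub>R h"
  have nn: "n \<bullet> n = 1" "h \<bullet> h = 1" using assms by (simp_all add: norm_eq_1)
  have "y \<bullet> n = 0" "y \<bullet> h = 0"
    using nn assms(3) by (simp_all add: y_def inner_diff_left inner_commute[of h n])
  then have "cross3 y ?T = 0"
    by (simp add: Lagrange)
  moreover have "?T \<bullet> ?T = 1"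
    using norm_cross_orthogonal[OF assms(2,3)] assms(1) by (simp flip: norm_eq_1)
  ultimately have "y = (?T \<bullet> y) *\<^sub>R ?T"
    using Lagrange[of ?T y ?T] by simp
  moreover have "?T \<bullet> y = x \<bullet> ?T"
    by (simp add: y_def inner_diff_right inner_commute[of ?T x] dot_cross_self)
  ultimately show ?thesis by (simp add: y_def algebra_simps)
qed

text \<open>Divided by \<open>norm (\<beta> s - b)\<close>, the increments of the position and of the orientation have norms
  tending to \<open>\<bar>1 + \<kappa> * d\<bar>\<close> and \<open>\<bar>\<kappa>\<bar>\<close>; monotonicity of the nearest-point map (assumption \<open>mono\<close>) gives
  \<open>0 \<le> 1 + \<kappa> * d\<close>. The offset curve need not be regular, so the focal case \<open>1 + \<kappa> * d = 0\<close> is covered.\<close>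

lemma turning_bound:
  fixes r e \<beta> :: "real \<Rightarrow> real^3" and \<nu> :: "real^3 \<Rightarrow> real^3" and h b :: "real^3"
  defines "\<tau> \<equiv> cross3 (\<nu> b) h"
  assumes F: "F = at t within S" "F \<noteq> bot"
    and frame: "norm h = 1" "norm (\<nu> b) = 1" "\<nu> b \<bullet> h = 0"
    and \<beta>: "(\<beta> \<longlongrightarrow> b) F" "\<forall>\<^sub>F s in F. (\<beta> s - b) \<bullet> h = 0"
    and g: "(g has_derivative (\<lambda>w. (\<nu> b + c *\<^sub>R h) \<bullet> w)) (at b)" "g b = 0" "\<forall>\<^sub>F s in F. g (\<beta> s) = (0::real)"
    and \<nu>: "(\<nu> has_derivative \<nu>') (at b)" "\<nu>' \<tau> = - \<kappa> *\<^sub>R \<tau>"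
    and r: "\<forall>\<^sub>F s in F. r s = \<beta> s - d *\<^sub>R \<nu> (\<beta> s)" "r t = b - d *\<^sub>R \<nu> b"
    and deriv: "(r has_vector_derivative v *\<^sub>R e t) (at t within S)" "v > 0" "norm (e t) = 1"
    and e: "\<forall>\<^sub>F s in F. norm (e s - e t) = norm (cross3 (\<nu> (\<beta> s)) h - \<tau>)"
      "\<forall>\<^sub>F s in F. norm (e s - e t) \<le> u * \<bar>s - t\<bar>"
    and mono: "\<forall>\<^sub>F s in F. 0 \<le> (r s - r t) \<bullet> (\<beta> s - b)"
  shows "\<bar>\<kappa>\<bar> * v \<le> u * (1 + \<kappa> * d)"
proof -
  have \<tau>1: "norm \<tau> = 1"
    using norm_cross_orthogonal[OF frame(1,3)] frame(2) by (simp add: \<tau>_def)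
  have \<tau>h: "\<tau> \<bullet> h = 0" by (simp add: \<tau>_def dot_cross_self)
  have ne: "\<forall>\<^sub>F s in F. s \<noteq> t"
    unfolding F(1) by (simp add: eventually_at_filter)
  have speed: "((\<lambda>s. norm (r s - r t) / \<bar>s - t\<bar>) \<longlongrightarrow> v) F"
  proof -
    have "((\<lambda>s. (r s - r t - (s - t) *\<^sub>R v *\<^sub>R e t) /\<^sub>R norm (s - t)) \<longlongrightarrow> 0) F"
      using deriv(1) unfolding F(1) has_vector_derivative_def has_derivative_at_within by blast
    from tendsto_norm_zero[OF this]
    have "((\<lambda>s. norm (r s - r t) / \<bar>s - t\<bar> - v) \<longlongrightarrow> 0) F"
    proof (rule Lim_null_comparison[rotated])
      show "\<forall>\<^sub>F s in F. norm (norm (r s - r t) / \<bar>s - t\<bar> - v)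
          \<le> norm ((r s - r t - (s - t) *\<^sub>R v *\<^sub>R e t) /\<^sub>R norm (s - t))"
        using ne
      proof eventually_elim
        case (elim s)
        have "norm (r s - r t) / \<bar>s - t\<bar> - v
            = (norm (r s - r t) - norm ((s - t) *\<^sub>R v *\<^sub>R e t)) / \<bar>s - t\<bar>"
          using elim deriv(2,3) by (simp add: divide_simps abs_mult)
        then show ?case
          using norm_triangle_ineq3[of "r s - r t" "(s - t) *\<^sub>R v *\<^sub>R e t"]
          by (simp add: divide_inverse_commute abs_mult mult_left_mono)
      qed
    qed
    then show ?thesis by (rule LIM_zero_cancel)
  qed
  have "\<forall>\<^sub>F s in F. 0 < norm (r s - r t) / \<bar>s - t\<bar>"
    using order_tendstoD(1)[OF speed deriv(2)] .
  \<comment> \<open>The position is determined by the nearest point, so \<open>\<beta> s = b\<close>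
    would give \<open>r s = r t\<close>, against the positive speed. This permits division by
    \<open>norm (\<beta> s - b)\<close>.\<close>
  with r(1) have w_ne: "\<forall>\<^sub>F s in F. \<beta> s \<noteq> b"
  proof eventually_elim
    case (elim s)
    show ?case
    proof
      assume "\<beta> s = b"
      then have "r s = r t" using elim(1) r(2) by simp
      then show False using elim(2) by simp
    qed
  qed
  then have lim: "filterlim \<beta> (at b) F"
    using \<beta>(1) by (simp add: filterlim_at)
  define x where "x = (\<lambda>s. sgn (\<beta> s - b))"
  define n where "n = (\<lambda>s. norm (\<beta> s - b))"
  \<comment> \<open>\<open>a\<close> and \<open>z\<close> are the tangential and normal coordinates
    of the direction \<open>x\<close>; \<open>y\<close> and, further down, \<open>q\<close> are the
    increments of \<open>\<nu>\<close> and of the position per unit displacement of the nearest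
    point.\<close>
  define a where "a = (\<lambda>s. x s \<bullet> \<tau>)"
  define z where "z = (\<lambda>s. x s \<bullet> \<nu> b)"
  define y where "y = (\<lambda>s. (\<nu> (\<beta> s) - \<nu> b) /\<^sub>R n s)"
  have xh: "\<forall>\<^sub>F s in F. x s \<bullet> h = 0"
    using \<beta>(2) by eventually_elim (simp add: x_def sgn_div_norm)
  have x_exp: "\<forall>\<^sub>F s in F. x s = a s *\<^sub>R \<tau> + z s *\<^sub>R \<nu> b"
    using xh
  proof eventually_elim
    case (elim s)
    show ?case
      using orthonormal_frame_expansion[OF frame(2,1,3), of "x s"] elim
      by (simp add: a_def z_def \<tau>_def)
  qed
  \<comment> \<open>The nearest point stays in the zero set of \<open>g\<close>, so its direction
    becomes orthogonal to the gradient; being horizontal, it does not feel the vertical part of the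
    gradient.\<close>
  have z0: "(z \<longlongrightarrow> 0) F"
  proof -
    have "((\<lambda>s. - ((\<nu> b + c *\<^sub>R h) \<bullet> x s)) \<longlongrightarrow> 0) F"
      by (rule Lim_transform_eventually[OF has_derivative_tendsto_quotient[OF g(1) lim]])
        (use g(3) in eventually_elim, simp add: g(2) x_def)
    then have "((\<lambda>s. (\<nu> b + c *\<^sub>R h) \<bullet> x s) \<longlongrightarrow> 0) F"
      using tendsto_minus_cancel[of "\<lambda>s. (\<nu> b + c *\<^sub>R h) \<bullet> x s" 0] by simp
    then show ?thesis
      by (rule Lim_transform_eventually)
        (use xh in eventually_elim, simp add: z_def inner_add_left inner_commute[of "\<nu> b"] inner_commute[of h])
  qed
  have a1: "((\<lambda>s. (a s)\<^sup>2) \<longlongrightarrow> 1) F"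
  proof -
    have "((\<lambda>s. 1 - (z s)\<^sup>2) \<longlongrightarrow> 1 - 0\<^sup>2) F"
      by (intro tendsto_intros z0)
    moreover have "\<forall>\<^sub>F s in F. 1 - (z s)\<^sup>2 = (a s)\<^sup>2"
      using x_exp w_ne
    proof eventually_elim
      case (elim s)
      have "1 = x s \<bullet> x s"
        using elim(2) by (simp add: x_def norm_sgn flip: norm_eq_1)
      also have "\<dots> = x s \<bullet> (a s *\<^sub>R \<tau> + z s *\<^sub>R \<nu> b)" using elim(1) by simp
      also have "\<dots> = (a s)\<^sup>2 + (z s)\<^sup>2"
        by (simp add: inner_add_right a_def z_def power2_eq_square)
      finally show ?case by simp
    qed
    ultimately show ?thesis
      using Lim_transform_eventually by fastforce
  qed
  \<comment> \<open>The sign of \<open>a s\<close> is left open and may vary with \<open>s\<close>;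
    the limits below therefore carry the factor \<open>a s\<close> or are taken of norms.\<close>
  then have abs_a: "((\<lambda>s. \<bar>a s\<bar>) \<longlongrightarrow> 1) F"
    using tendsto_real_sqrt[OF a1] by simp
  have lin: "linear \<nu>'" using \<nu>(1) by (rule has_derivative_linear)
  have y0: "((\<lambda>s. y s + (\<kappa> * a s) *\<^sub>R \<tau>) \<longlongrightarrow> 0) F"
  proof -
    have "((\<lambda>s. (y s - \<nu>' (x s)) + z s *\<^sub>R \<nu>' (\<nu> b)) \<longlongrightarrow> 0 + 0 *\<^sub>R \<nu>' (\<nu> b)) F"
      unfolding y_def x_def n_def
      by (intro tendsto_intros z0 has_derivative_tendsto_quotient[OF \<nu>(1) lim])
    moreover have "\<forall>\<^sub>F s in F. (y s - \<nu>' (x s)) + z s *\<^sub>R \<nu>' (\<nu> b) = y s + (\<kappa> * a s) *\<^sub>R \<tau>"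
      using x_exp
    proof eventually_elim
      case (elim s)
      have "\<nu>' (x s) = a s *\<^sub>R \<nu>' \<tau> + z s *\<^sub>R \<nu>' (\<nu> b)"
        by (subst elim) (simp add: linear_add[OF lin] linear_cmul[OF lin])
      then show ?case by (simp add: \<nu>(2))
    qed
    ultimately show ?thesis
      using Lim_transform_eventually by fastforce
  qed
  define q where "q = (\<lambda>s. (r s - r t) /\<^sub>R n s)"
  have q0: "((\<lambda>s. q s - (a s * (1 + \<kappa> * d)) *\<^sub>R \<tau>) \<longlongrightarrow> 0) F"
  proof -
    have "((\<lambda>s. z s *\<^sub>R \<nu> b - d *\<^sub>R (y s + (\<kappa> * a s) *\<^sub>R \<tau>)) \<longlongrightarrow> 0 *\<^sub>R \<nu> b - d *\<^sub>R 0) F"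
      by (intro tendsto_intros z0 y0)
    moreover have "\<forall>\<^sub>F s in F. z s *\<^sub>R \<nu> b - d *\<^sub>R (y s + (\<kappa> * a s) *\<^sub>R \<tau>)
        = q s - (a s * (1 + \<kappa> * d)) *\<^sub>R \<tau>"
      using x_exp r(1)
    proof eventually_elim
      case (elim s)
      have "q s = x s - d *\<^sub>R y s"
        unfolding q_def x_def y_def n_def sgn_div_norm elim(2) r(2)
        by (simp add: algebra_simps)
      then show ?case using elim(1) by (simp add: algebra_simps)
    qed
    ultimately show ?thesis
      using Lim_transform_eventually by fastforce
  qed
  have norm_lim: "((\<lambda>s. norm (f s)) \<longlongrightarrow> \<bar>k\<bar>) F"
    if "((\<lambda>s. f s - (a s * k) *\<^sub>R \<sigma>) \<longlongrightarrow> 0) F" "norm \<sigma> = 1" for f :: "real \<Rightarrow> real^3" and k \<sigma>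
  proof -
    have "((\<lambda>s. norm (f s) - \<bar>a s\<bar> * \<bar>k\<bar>) \<longlongrightarrow> 0) F"
    proof (rule Lim_null_comparison[OF always_eventually tendsto_norm_zero[OF that(1)]], rule allI)
      fix s
      show "norm (norm (f s) - \<bar>a s\<bar> * \<bar>k\<bar>) \<le> norm (f s - (a s * k) *\<^sub>R \<sigma>)"
        using norm_triangle_ineq3[of "f s" "(a s * k) *\<^sub>R \<sigma>"] that(2) by (simp add: abs_mult)
    qed
    from tendsto_add[OF this tendsto_mult_right[OF abs_a, of "\<bar>k\<bar>"]] show ?thesis by simp
  qed
  have qlim: "((\<lambda>s. norm (q s)) \<longlongrightarrow> \<bar>1 + \<kappa> * d\<bar>) F"
    using norm_lim[OF q0 \<tau>1] .
  have elim: "((\<lambda>s. norm (e s - e t) / n s) \<longlongrightarrow> \<bar>\<kappa>\<bar>) F"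
  proof -
    from bounded_linear.tendsto[OF bounded_linear_cross_left y0]
    have "((\<lambda>s. cross3 (y s) h - (a s * (- \<kappa>)) *\<^sub>R cross3 \<tau> h) \<longlongrightarrow> 0) F"
      by (simp add: cross_add_left cross_mult_left mult.commute)
    from norm_lim[OF this] have "((\<lambda>s. norm (cross3 (y s) h)) \<longlongrightarrow> \<bar>\<kappa>\<bar>) F"
      using norm_cross_orthogonal[OF frame(1) \<tau>h] \<tau>1 by simp
    moreover have "\<forall>\<^sub>F s in F. norm (cross3 (y s) h) = norm (e s - e t) / n s"
      using e(1)
    proof eventually_elim
      case (elim s)
      have "cross3 (y s) h = (cross3 (\<nu> (\<beta> s)) h - \<tau>) /\<^sub>R n s"
        by (simp add: y_def cross_mult_left \<tau>_def Cross3.left_diff_distrib)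
      then show ?case using elim by (simp add: n_def divide_inverse_commute)
    qed
    ultimately show ?thesis
      using Lim_transform_eventually by fastforce
  qed
  \<comment> \<open>Pairing \<open>q s\<close> with \<open>x s\<close> turns the factor
    \<open>a s\<close> into its square, which tends to 1. The sign of
    \<open>1 + \<kappa> * d\<close> becomes visible, and \<open>mono\<close> decides it.\<close>
  have "((\<lambda>s. (q s - (a s * (1 + \<kappa> * d)) *\<^sub>R \<tau>) \<bullet> x s + (a s)\<^sup>2 * (1 + \<kappa> * d)) \<longlongrightarrow> 0 + 1 * (1 + \<kappa> * d)) F"
  proof (intro tendsto_add tendsto_mult a1 tendsto_const)
    show "((\<lambda>s. (q s - (a s * (1 + \<kappa> * d)) *\<^sub>R \<tau>) \<bullet> x s) \<longlongrightarrow> 0) F"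
    proof (rule Lim_null_comparison[OF always_eventually tendsto_norm_zero[OF q0]], rule allI)
      fix s
      let ?A = "q s - (a s * (1 + \<kappa> * d)) *\<^sub>R \<tau>"
      have "norm (x s) \<le> 1" by (simp add: x_def norm_sgn)
      then have "norm ?A * norm (x s) \<le> norm ?A * 1" by (intro mult_left_mono) auto
      then show "norm (?A \<bullet> x s) \<le> norm ?A"
        using Cauchy_Schwarz_ineq2[of ?A "x s"] by simp
    qed
  qed
  moreover have "(q s - (a s * (1 + \<kappa> * d)) *\<^sub>R \<tau>) \<bullet> x s + (a s)\<^sup>2 * (1 + \<kappa> * d) = q s \<bullet> x s" for s
    by (simp add: inner_diff_left a_def inner_commute[of \<tau>] power2_eq_square)
  ultimately have "((\<lambda>s. q s \<bullet> x s) \<longlongrightarrow> 1 + \<kappa> * d) F"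
    by simp
  moreover have "\<forall>\<^sub>F s in F. 0 \<le> q s \<bullet> x s"
    using mono by eventually_elim (simp add: q_def x_def sgn_div_norm n_def)
  ultimately have nonneg: "0 \<le> 1 + \<kappa> * d"
    using tendsto_lowerbound F(2) by blast
  \<comment> \<open>Exchanging the denominators \<open>n s\<close> and
    \<open>\<bar>s - t\<bar>\<close> converts the Lipschitz bound in time into one per displacement
    of the nearest point.\<close>
  have "((\<lambda>s. norm (e s - e t) / n s * (norm (r s - r t) / \<bar>s - t\<bar>)) \<longlongrightarrow> \<bar>\<kappa>\<bar> * v) F"
    by (intro tendsto_mult elim speed)
  moreover have "((\<lambda>s. u * norm (q s)) \<longlongrightarrow> u * \<bar>1 + \<kappa> * d\<bar>) F"
    by (intro tendsto_mult tendsto_const qlim)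
  moreover have "\<forall>\<^sub>F s in F. norm (e s - e t) / n s * (norm (r s - r t) / \<bar>s - t\<bar>) \<le> u * norm (q s)"
    using e(2) ne w_ne
  proof eventually_elim
    case (elim s)
    have "norm (e s - e t) / \<bar>s - t\<bar> \<le> u"
      using elim by (simp add: divide_le_eq)
    then have "norm (e s - e t) / \<bar>s - t\<bar> * (norm (r s - r t) / n s) \<le> u * (norm (r s - r t) / n s)"
      by (rule mult_right_mono) (simp add: n_def)
    then show ?case by (simp add: q_def n_def divide_inverse_commute mult_ac)
  qed
  ultimately have "\<bar>\<kappa>\<bar> * v \<le> u * \<bar>1 + \<kappa> * d\<bar>"
    using tendsto_le[OF F(2)] by blast
  then show "\<bar>\<kappa>\<bar> * v \<le> u * (1 + \<kappa> * d)" using nonneg by simp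
qed

section \<open>Horizontal geometry of the boundary\<close>

definition hproj :: "real^3 \<Rightarrow> real^3 \<Rightarrow> real^3" where
  "hproj h w = w - (w \<bullet> h) *\<^sub>R h"

text \<open>This is \<nu> of the overview, the normal of the slice through \<open>b\<close> within
  its horizontal plane.\<close>

definition hnormal :: "(real^3) set \<Rightarrow> real^3 \<Rightarrow> real^3 \<Rightarrow> real^3" where
  "hnormal D h b = sgn (hproj h (inward_normal D b))"

lemma hproj_scaleR: "hproj h (c *\<^sub>R w) = c *\<^sub>R hproj h w"
  by (simp add: hproj_def scaleR_diff_right)

lemma hproj_inner_h: "norm h = 1 \<Longrightarrow> hproj h w \<bullet> h = 0"
  by (simp add: hproj_def inner_diff_left norm_eq_1)

lemma inner_hproj: "norm h = 1 \<Longrightarrow> w \<bullet> hproj h w = (norm (hproj h w))\<^sup>2"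
  by (simp add: hproj_def power2_norm_eq_inner inner_diff_left inner_diff_right norm_eq_1 inner_commute)

lemma hproj_inner_orth: "x \<bullet> h = 0 \<Longrightarrow> hproj h w \<bullet> x = w \<bullet> x"
  by (simp add: hproj_def inner_diff_left inner_commute[of h x])

lemma bounded_linear_hproj: "bounded_linear (hproj h)"
  unfolding hproj_def
  by (intro bounded_linear_sub bounded_linear_ident bounded_linear_scaleR_const bounded_linear_inner_left)

lemma hproj_nonzero: "\<not> collinear {0, w, h} \<Longrightarrow> hproj h w \<noteq> 0"
  unfolding hproj_def
  by (metis collinear_lemma insert_commute right_minus_eq)

lemma cross3_hproj: "cross3 (hproj h w) h = cross3 w h"
  by (simp add: hproj_def Cross3.left_diff_distrib cross_mult_left)

lemma sin_angle_between:
  assumes "norm w = 1" "norm h = 1"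
  shows "sin (angle_between w h) = norm (hproj h w)"
proof -
  have "\<bar>w \<bullet> h\<bar> \<le> 1" using Cauchy_Schwarz_ineq2[of w h] assms by simp
  then have "sin (angle_between w h) = sqrt (1 - (w \<bullet> h)\<^sup>2)"
    using assms by (simp add: angle_between_def sin_arccos_abs)
  moreover have "(norm (hproj h w))\<^sup>2 = 1 - (w \<bullet> h)\<^sup>2"
  proof -
    have "(norm (hproj h w))\<^sup>2 = hproj h w \<bullet> hproj h w" by (rule power2_norm_eq_inner)
    also have "\<dots> = 1 - (w \<bullet> h)\<^sup>2"
      using assms
      by (simp add: hproj_def norm_eq_1 power2_eq_square inner_diff_left inner_diff_right inner_commute[of h w])
    finally show ?thesis .
  qed
  ultimately show ?thesis by (metis norm_ge_zero real_sqrt_unique)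
qed

lemma sgn_orthonormal:
  fixes m :: "'a::real_inner"
  shows "m \<bullet> h = 0 \<Longrightarrow> sgn m \<bullet> h = 0"
  by (simp add: sgn_div_norm)

lemma unit_horizontal_tangent_eq:
  assumes "norm (inward_normal D b) = 1" "norm h = 1"
  shows "unit_horizontal_tangent D h b = cross3 (hnormal D h b) h"
  by (simp add: unit_horizontal_tangent_def hnormal_def sin_angle_between[OF assms]
      sgn_div_norm cross_mult_left cross3_hproj divide_inverse)

context defining_function
begin

lemma hnormal_eq:
  assumes "x \<in> U" "x \<in> frontier D"
  shows "hnormal D h x = sgn (hproj h (G x))"
  using G_nz[OF assms(1)]
  by (simp add: hnormal_def inward_normal_eq[OF assms] hproj_scaleR sgn_scaleR)

lemma hproj_G_nonzero:
  assumes "b \<in> U" "b \<in> frontier D" "\<not> collinear {0, inward_normal D b, h}"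
  shows "hproj h (G b) \<noteq> 0"
  using hproj_nonzero[OF assms(3)] by (simp add: inward_normal_eq[OF assms(1,2)] hproj_scaleR)

lemma norm_inward_normal:
  assumes "b \<in> U" "b \<in> frontier D"
  shows "norm (inward_normal D b) = 1"
  using G_nz[OF assms(1)] by (simp add: inward_normal_eq[OF assms])

text \<open>The field is horizontal and of unit length, so its derivative is orthogonal to
  \<open>h\<close> and to the field, leaving a multiple of \<open>T\<close>. The factor 1 / sin
  \<theta> appears because \<open>hproj h (G b)\<close> has norm sin \<theta> times
  \<open>norm (G b)\<close>.\<close>

lemma hnormal_derivative:
  assumes b: "b \<in> U" "b \<in> frontier D" "\<not> collinear {0, inward_normal D b, h}" and h: "norm h = 1"
  defines "T \<equiv> unit_horizontal_tangent D h b"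
  obtains \<nu>' where "((\<lambda>x. sgn (hproj h (G x))) has_derivative \<nu>') (at b)"
    "\<nu>' T = - (second_ff D b T T / sin (angle_between (inward_normal D b) h)) *\<^sub>R T"
proof -
  define m where "m = (\<lambda>x. hproj h (G x))"
  define \<nu> where "\<nu> = sgn (m b)"
  have mb: "m b \<noteq> 0" using hproj_G_nonzero[OF b] by (simp add: m_def)
  have \<nu>: "norm \<nu> = 1" "\<nu> \<bullet> h = 0"
    using mb hproj_inner_h[OF h] by (simp_all add: \<nu>_def norm_sgn m_def sgn_orthonormal)
  have T: "T = cross3 \<nu> h"
    unfolding T_def \<nu>_def m_def
    using unit_horizontal_tangent_eq[OF norm_inward_normal[OF b(1,2)] h] hnormal_eq[OF b(1,2)] by simp
  have Th: "T \<bullet> h = 0" and T\<nu>: "T \<bullet> \<nu> = 0" by (simp_all add: T dot_cross_self)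
  have Tm: "T \<bullet> m b = 0"
    using T\<nu> mb by (simp add: \<nu>_def sgn_div_norm)
  have GT: "G b \<bullet> T = 0"
    using hproj_inner_orth[OF Th, of "G b"] Tm by (simp add: m_def inner_commute)
  have T1: "norm T = 1" using norm_cross_orthogonal[OF h \<nu>(2)] \<nu>(1) by (simp add: T)
  obtain G' where G': "(G has_derivative G') (at b)"
    using G_diff[OF b(1)] by (auto simp: differentiable_def)
  have m': "(m has_derivative (\<lambda>w. hproj h (G' w))) (at b)"
    unfolding m_def using bounded_linear.has_derivative[OF bounded_linear_hproj G'] .
  have "norm differentiable (at (m b))"
    using mb differentiable_norm_at by blast
  then have "(\<lambda>x. norm (m x)) differentiable (at b)"
    using m' differentiable_chain_at[of m b norm] by (auto simp: differentiable_def o_def)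
  then have "(\<lambda>x. inverse (norm (m x))) differentiable (at b)"
    using mb by (simp add: differentiable_inverse)
  then obtain q where q: "((\<lambda>x. inverse (norm (m x))) has_derivative q) (at b)"
    by (auto simp: differentiable_def)
  define \<nu>' where "\<nu>' = (\<lambda>w. inverse (norm (m b)) *\<^sub>R hproj h (G' w) + q w *\<^sub>R m b)"
  have \<nu>': "((\<lambda>x. sgn (m x)) has_derivative \<nu>') (at b)"
    unfolding \<nu>'_def sgn_div_norm by (rule has_derivative_scaleR[OF q m'])
  have "\<nu>' T \<bullet> h = 0"
    using hproj_inner_h[OF h] by (simp add: \<nu>'_def inner_add_left m_def)
  moreover have "\<nu>' T \<bullet> \<nu> = 0"
  proof -
    have d: "((\<lambda>x. sgn (m x) \<bullet> sgn (m x)) has_derivative (\<lambda>w. \<nu> \<bullet> \<nu>' w + \<nu>' w \<bullet> \<nu>)) (at b)"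
      unfolding \<nu>_def by (rule has_derivative_inner[OF \<nu>' \<nu>'])
    have "isCont m b" using m' has_derivative_continuous by blast
    then have "\<forall>\<^sub>F x in nhds b. m x \<noteq> 0"
      using mb tendsto_imp_eventually_ne[of m "m b" "nhds b" 0]
      by (simp add: isCont_def tendsto_at_iff_tendsto_nhds)
    then obtain S where S: "open S" "b \<in> S" "\<And>x. x \<in> S \<Longrightarrow> m x \<noteq> 0"
      by (auto simp: eventually_nhds)
    have "((\<lambda>x. 1::real) has_derivative (\<lambda>w. \<nu> \<bullet> \<nu>' w + \<nu>' w \<bullet> \<nu>)) (at b)"
      by (rule has_derivative_transform_within_open[OF d S(1,2)])
        (use S(3) in \<open>simp add: norm_sgn flip: norm_eq_1\<close>)
    then have "(\<lambda>w. \<nu> \<bullet> \<nu>' w + \<nu>' w \<bullet> \<nu>) = (\<lambda>w. 0)"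
      using has_derivative_unique has_derivative_const by blast
    then have "\<nu> \<bullet> \<nu>' T + \<nu>' T \<bullet> \<nu> = 0" by metis
    then show ?thesis by (simp add: inner_commute)
  qed
  ultimately have "\<nu>' T = (\<nu>' T \<bullet> T) *\<^sub>R T"
    using orthonormal_frame_expansion[OF \<nu>(1) h \<nu>(2), of "\<nu>' T"] by (simp add: T)
  moreover have "\<nu>' T \<bullet> T = - (second_ff D b T T / sin (angle_between (inward_normal D b) h))"
  proof -
    have "\<nu>' T \<bullet> T = (G' T \<bullet> T) / norm (m b)"
      using Tm by (simp add: \<nu>'_def inner_add_left hproj_inner_orth[OF Th] inner_commute[of "m b"]
          divide_inverse)
    moreover have "sin (angle_between (inward_normal D b) h) = norm (m b) / norm (G b)"
      using sin_angle_between[OF norm_inward_normal[OF b(1,2)] h]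
      by (simp add: inward_normal_eq[OF b(1,2)] hproj_scaleR m_def divide_inverse)
    ultimately show ?thesis
      using second_ff_eq[OF b(1,2) GT G'] G_nz[OF b(1)] mb by simp
  qed
  ultimately show thesis
    using that \<nu>' unfolding m_def by (metis scaleR_minus_left)
qed

end

section \<open>Chart-free geometry at a boundary point with non-vertical normal\<close>

locale transversal_point =
  fixes D :: "(real^3) set" and h b :: "real^3"
  assumes closed: "closed D" and smooth: "Ck_domain 3 D" and b: "b \<in> frontier D"
    and h: "norm h = 1" and transversal: "\<not> collinear {0, inward_normal D b, h}"
begin

lemma chart:
  obtains U g G where "b \<in> U" "defining_function D U g G"
  using Ck_domain_defining_function smooth b frontier_subset_closed[OF closed] by blast

lemma norm_normal: "norm (inward_normal D b) = 1"
  using chart defining_function.norm_inward_normal b by metis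

lemma sin_angle_pos: "0 < sin (angle_between (inward_normal D b) h)"
  using sin_angle_between[OF norm_normal h] hproj_nonzero[OF transversal] by simp

lemma hnormal_unit: "norm (hnormal D h b) = 1" and hnormal_horizontal: "hnormal D h b \<bullet> h = 0"
  using hproj_nonzero[OF transversal] hproj_inner_h[OF h]
  by (simp_all add: hnormal_def norm_sgn sgn_orthonormal)

lemma tangent_eq: "unit_horizontal_tangent D h b = cross3 (hnormal D h b) h"
  using unit_horizontal_tangent_eq[OF norm_normal h] .

text \<open>The chart moves points along \<open>hproj h (G b)\<close>. By transversality this
  direction is nonzero and not tangent, and as it is horizontal the altitude is preserved
  exactly.\<close>

lemma horizontal_curve:
  obtains c where "curve_through (frontier D) b (cross3 (hnormal D h b) h) c"
    "\<forall>\<^sub>F t in nhds 0. c t \<bullet> h = b \<bullet> h"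
proof -
  obtain U g G where bU: "b \<in> U" and "defining_function D U g G" using chart .
  then interpret defining_function D U g G by simp
  let ?m = "hproj h (G b)" and ?T = "cross3 (hnormal D h b) h"
  have m: "?m \<noteq> 0" using hproj_G_nonzero[OF bU b transversal] .
  have Gm: "G b \<bullet> ?m \<noteq> 0" using m inner_hproj[OF h, of "G b"] by simp
  have Th: "?T \<bullet> h = 0" by (simp add: dot_cross_self)
  have "G b \<bullet> ?T = ?m \<bullet> ?T"
    using hproj_inner_orth[OF Th] by simp
  also have "\<dots> = norm ?m * (sgn ?m \<bullet> ?T)" using m by (simp add: sgn_div_norm)
  also have "\<dots> = 0" by (simp add: hnormal_eq[OF bU b] dot_cross_self)
  finally obtain c where c: "curve_through (frontier D) b ?T c"
    "\<And>k. k \<bullet> ?m = 0 \<Longrightarrow> \<forall>\<^sub>F t in nhds 0. c t \<bullet> k = b \<bullet> k + t * (?T \<bullet> k)"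
    using curve_through_frontier[OF bU b Gm] by blast
  have "h \<bullet> ?m = 0" using hproj_inner_h[OF h] by (simp add: inner_commute)
  then show thesis using c(2)[of h] that[OF c(1)] Th by simp
qed

lemma connected_slab:
  obtains W where "open W" "b \<in> W" "connected (W \<inter> (frontier D \<inter> {x. x \<bullet> h \<in> {l..u}}))"
proof -
  obtain U g G where bU: "b \<in> U" and "defining_function D U g G" using chart .
  then interpret defining_function D U g G by simp
  have "G b \<bullet> hproj h (G b) \<noteq> 0"
    using hproj_G_nonzero[OF bU b transversal] inner_hproj[OF h, of "G b"] by simp
  moreover have "h \<bullet> hproj h (G b) = 0" using hproj_inner_h[OF h] by (simp add: inner_commute)
  ultimately show thesis
    using connected_frontier_slab[OF bU b] that by blast
qed

lemma enters_interior:
  assumes "w \<bullet> h = 0" "0 < hnormal D h b \<bullet> w"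
  shows "\<forall>\<^sub>F t in at_right 0. b + t *\<^sub>R w \<in> D"
proof -
  obtain U g G where bU: "b \<in> U" and "defining_function D U g G" using chart .
  then interpret defining_function D U g G by simp
  have "0 < hproj h (G b) \<bullet> w"
    using assms(2) by (simp add: hnormal_eq[OF bU b] sgn_div_norm zero_less_mult_iff)
  then have "0 < G b \<bullet> w" using hproj_inner_orth[OF assms(1)] by simp
  moreover have "g b = 0" using mem_frontier_iff bU b by blast
  ultimately have "\<forall>\<^sub>F t in at_right 0. g (b + t *\<^sub>R w) > 0"
    using eventually_line_pos[OF bU] by blast
  with eventually_line_in_U[OF bU, of w] show ?thesis
    by eventually_elim (use mem_iff in force)
qed

text \<open>Dividing a defining function by the norm of the horizontal part of its gradient makes
  that part equal to \<open>hnormal D h b\<close>.\<close>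

lemma local_equation:
  obtains g c where "(g has_derivative (\<lambda>w. (hnormal D h b + c *\<^sub>R h) \<bullet> w)) (at b)" "g b = (0::real)"
    "\<forall>\<^sub>F x in nhds b. x \<in> frontier D \<longrightarrow> g x = 0"
proof -
  obtain U g G where bU: "b \<in> U" and "defining_function D U g G" using chart .
  then interpret defining_function D U g G by simp
  let ?k = "norm (hproj h (G b))"
  have "G b = hproj h (G b) + (G b \<bullet> h) *\<^sub>R h" by (simp add: hproj_def)
  then have "G b /\<^sub>R ?k = hnormal D h b + ((G b \<bullet> h) / ?k) *\<^sub>R h"
    unfolding hnormal_eq[OF bU b] sgn_div_norm
    by (metis divide_inverse_commute scaleR_add_right scaleR_scaleR)
  moreover have "((\<lambda>x. g x / ?k) has_derivative (\<lambda>w. (G b /\<^sub>R ?k) \<bullet> w)) (at b)"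
    by (auto intro!: derivative_eq_intros g_deriv[OF bU] simp: divide_inverse_commute)
  ultimately show thesis
  proof (intro that[of "\<lambda>x. g x / ?k"])
    show "g b / ?k = 0" using mem_frontier_iff bU b by simp
    have "\<forall>\<^sub>F x in nhds b. x \<in> U" using eventually_nhds_in_open[OF open_U bU] .
    then show "\<forall>\<^sub>F x in nhds b. x \<in> frontier D \<longrightarrow> g x / ?k = 0"
      by eventually_elim (use mem_frontier_iff in simp)
  qed simp
qed

text \<open>Normals belong to boundary points only, so what is differentiated is an extension
  \<open>\<nu>\<close> to a neighbourhood of \<open>b\<close> in space.\<close>

lemma hnormal_derivative:
  defines "T \<equiv> unit_horizontal_tangent D h b"
  obtains \<nu> \<nu>' where "\<forall>\<^sub>F x in nhds b. x \<in> frontier D \<longrightarrow> hnormal D h x = \<nu> x"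
    "(\<nu> has_derivative \<nu>') (at b)"
    "\<nu>' T = - (second_ff D b T T / sin (angle_between (inward_normal D b) h)) *\<^sub>R T"
proof -
  obtain U g G where bU: "b \<in> U" and "defining_function D U g G" using chart .
  then interpret defining_function D U g G by simp
  have "\<forall>\<^sub>F x in nhds b. x \<in> U" using eventually_nhds_in_open[OF open_U bU] .
  then have "\<forall>\<^sub>F x in nhds b. x \<in> frontier D \<longrightarrow> hnormal D h x = sgn (hproj h (G x))"
    by eventually_elim (use hnormal_eq in simp)
  moreover obtain \<nu>' where "((\<lambda>x. sgn (hproj h (G x))) has_derivative \<nu>') (at b)"
    "\<nu>' T = - (second_ff D b T T / sin (angle_between (inward_normal D b) h)) *\<^sub>R T"
    unfolding T_def by (rule hnormal_derivative[OF bU b transversal h])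
  ultimately show thesis by (rule that)
qed

end

section \<open>Motion at a constant distance\<close>

text \<open>For a neighbourhood \<open>A\<close> of \<open>b\<close>, the distance from
  \<open>p\<close> to \<open>Z - A\<close> is attained and so exceeds \<open>d\<close> strictly. By
  continuity this persists for \<open>r s\<close>, which forces \<open>\<beta> s\<close> into
  \<open>A\<close>.\<close>

lemma nearest_point_tendsto:
  fixes Z :: "'a::heine_borel set"
  assumes "closed Z" "(r \<longlongrightarrow> p) F" "\<forall>\<^sub>F s in F. \<beta> s \<in> Z \<and> dist (r s) (\<beta> s) \<le> d"
    and uniq: "\<And>y. y \<in> Z \<Longrightarrow> y \<noteq> b \<Longrightarrow> d < dist p y"
  shows "(\<beta> \<longlongrightarrow> b) F"
proof (rule topological_tendstoI)
  fix A assume A: "open A" "b \<in> A"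
  show "\<forall>\<^sub>F s in F. \<beta> s \<in> A"
  proof (cases "Z - A = {}")
    case True
    show ?thesis
      using assms(3) by eventually_elim (use True in blast)
  next
    case False
    have "closed (Z - A)" using assms(1) A by blast
    then obtain y where "y \<in> Z - A" "infdist p (Z - A) = dist p y"
      using infdist_attains_inf False by metis
    then have "d < infdist p (Z - A)" using uniq[of y] A by auto
    moreover have "((\<lambda>s. infdist (r s) (Z - A)) \<longlongrightarrow> infdist p (Z - A)) F"
      by (rule tendsto_infdist[OF assms(2)])
    ultimately have "\<forall>\<^sub>F s in F. d < infdist (r s) (Z - A)"
      using order_tendstoD(1) by blast
    with assms(3) show ?thesis
    proof eventually_elim
      case (elim s)
      show ?case
      proof (rule ccontr)
        assume "\<beta> s \<notin> A"
        then have "infdist (r s) (Z - A) \<le> dist (r s) (\<beta> s)"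
          using elim by (intro infdist_le) blast
        then show False using elim by simp
      qed
    qed
  qed
qed

text \<open>It serves in both roles: for a boundary curve seen from a fixed robot position, and for
  the trajectory seen from a fixed nearest point.\<close>

lemma inner_eq_0_at_local_min_dist:
  fixes c :: "real \<Rightarrow> 'a::real_inner"
  assumes "(c has_vector_derivative w) (at t)" "\<forall>\<^sub>F s in nhds t. dist (c t) p \<le> dist (c s) p"
  shows "w \<bullet> (c t - p) = 0"
proof -
  have "((\<lambda>s. (c s - p) \<bullet> (c s - p)) has_vector_derivative (c t - p) \<bullet> w + w \<bullet> (c t - p)) (at t)"
    using assms(1) by (auto intro!: derivative_eq_intros
        bounded_bilinear.has_vector_derivative[OF bounded_bilinear_inner])
  then have d: "((\<lambda>s. (c s - p) \<bullet> (c s - p)) has_real_derivative 2 * (w \<bullet> (c t - p))) (at t)"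
    by (simp add: has_real_derivative_iff_has_vector_derivative inner_commute)
  obtain \<delta> where \<delta>: "\<delta> > 0" "\<And>s. dist s t < \<delta> \<Longrightarrow> dist (c t) p \<le> dist (c s) p"
    using assms(2) by (auto simp: eventually_nhds_metric)
  have "2 * (w \<bullet> (c t - p)) = 0"
  proof (rule DERIV_local_min[OF d \<delta>(1)], intro allI impI)
    fix s assume "\<bar>t - s\<bar> < \<delta>"
    then have "(dist (c t) p)\<^sup>2 \<le> (dist (c s) p)\<^sup>2"
      using \<delta>(2)[of s] by (simp add: dist_real_def abs_minus_commute power_mono)
    then show "(c t - p) \<bullet> (c t - p) \<le> (c s - p) \<bullet> (c s - p)"
      by (simp add: dist_norm power2_norm_eq_inner)
  qed
  then show ?thesis by simp
qed

lemma admissible_motion_Lipschitz: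
  assumes "admissible_motion v umax T r e u" "0 \<le> s" "s \<le> t" "t \<le> T"
  shows "norm (e t - e s) \<le> umax * (t - s)"
proof -
  have int: "(u has_integral (e t - e 0)) {0..t}" "(u has_integral (e s - e 0)) {0..s}"
    and le: "\<And>x. x \<in> {0..T} \<Longrightarrow> norm (u x) \<le> umax"
    using assms by (auto simp: admissible_motion_def)
  have io: "u integrable_on {0..t}" using int by blast
  have "integral {0..s} u + integral {s..t} u = integral {0..t} u"
    using Henstock_Kurzweil_Integration.integral_combine[OF assms(2,3) io] .
  then have "integral {s..t} u = integral {0..t} u - integral {0..s} u"
    by (metis add_diff_cancel_left')
  then have "integral {s..t} u = e t - e s"
    unfolding integral_unique[OF int(1)] integral_unique[OF int(2)] by simp
  moreover have "(u has_integral integral {s..t} u) {s..t}"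
    by (intro integrable_integral integrable_subinterval_real[OF io]) (use assms in simp)
  ultimately have "(u has_integral (e t - e s)) {s..t}" by simp
  moreover have "0 \<le> umax" by (rule order_trans[OF norm_ge_zero le[of 0]]) (use assms in simp)
  ultimately have "norm (e t - e s) \<le> umax * measure lborel {s..t}"
    by (intro has_integral_bound_real[where S = "{}" and f = u]) (use le assms in auto)
  then show ?thesis using assms by simp
qed

text \<open>\<open>E\<close> stands for \<open>Dout\<close>. That \<open>B\<close> is a component
  enters through compactness and relative openness, which together separate it from the rest of the
  boundary in the layer.\<close>

locale layered_boundary =
  fixes D B E :: "(real^3) set" and h :: "real^3" and a l u :: real
  assumes closed_D: "closed D" and smooth: "Ck_domain 3 D" and h: "norm h = 1"
    and B: "B \<subseteq> frontier D" "compact B"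
      "openin (top_of_set (frontier D \<inter> layer h a l u)) B"
    and transversal: "x \<in> B \<Longrightarrow> \<not> collinear {0, inward_normal D x, h}"
    and E: "connected E" "E \<subseteq> layer h a l u - D" "B \<subseteq> closure E"
begin

lemma transversal_point: "x \<in> B \<Longrightarrow> transversal_point D h x"
  using closed_D smooth h B transversal by unfold_locales auto

lemma layer_eq: "layer h a l u = {x. l - a \<le> h \<bullet> x} \<inter> {x. h \<bullet> x \<le> u - a}"
  by (auto simp: layer_def altitude_def inner_commute)

lemma closed_layer: "closed (layer h a l u)" and convex_layer: "convex (layer h a l u)"
  unfolding layer_eq
  by (intro closed_Int convex_Int closed_halfspace_le closed_halfspace_ge
      convex_halfspace_le convex_halfspace_ge)+

lemma B_layer: "B \<subseteq> layer h a l u"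
  using openin_imp_subset[OF B(3)] by blast

text \<open>Constant altitude keeps the curve in the layer even if \<open>x\<close> is on an edge;
  relative openness then keeps it in \<open>B\<close>.\<close>

lemma frontier_curve_in_B:
  assumes "x \<in> B" "curve_through (frontier D) x V c" "\<forall>\<^sub>F t in nhds 0. c t \<bullet> h = x \<bullet> h"
  shows "\<forall>\<^sub>F t in nhds 0. c t \<in> B \<and> altitude h a (c t) = altitude h a x"
proof -
  have c: "c 0 = x" "(c has_vector_derivative V) (at 0)" "\<forall>\<^sub>F t in nhds 0. c t \<in> frontier D"
    using assms(2) by (auto simp: curve_through_def)
  obtain W where W: "open W" "B = (frontier D \<inter> layer h a l u) \<inter> W"
    using B(3) by (auto simp: openin_open)
  have "isCont c 0"
    using c(2) has_vector_derivative_continuous by blast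
  then have "\<forall>\<^sub>F t in nhds 0. c t \<in> W"
    using topological_tendstoD[OF _ W(1)] W(2) assms(1) c(1)
    unfolding isCont_def tendsto_at_iff_tendsto_nhds by blast
  with c(3) assms(3) show ?thesis
  proof eventually_elim
    case (elim t)
    then have "altitude h a (c t) = altitude h a x" by (simp add: altitude_def)
    moreover from this have "c t \<in> layer h a l u"
      using B_layer assms(1) by (auto simp: layer_def)
    ultimately show ?case using elim W(2) by blast
  qed
qed

text \<open>First-order optimality along a horizontal boundary curve leaves two candidates, on
  either side of \<open>x\<close> along the normal. The wrong one is excluded because its segment
  would start into \<open>D\<close>.\<close>

lemma nearest_point_offset:
  assumes "x \<in> B" "p \<in> E" "altitude h a p = altitude h a x" "0 < d" "dist p x = d"
    and far: "\<And>y. y \<in> B \<Longrightarrow> altitude h a y = altitude h a x \<Longrightarrow> d \<le> dist p y"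
  shows "p = x - d *\<^sub>R hnormal D h x"
proof -
  interpret transversal_point D h x using transversal_point[OF assms(1)] .
  let ?n = "hnormal D h x"
  obtain c where c: "curve_through (frontier D) x (cross3 ?n h) c" "\<forall>\<^sub>F t in nhds 0. c t \<bullet> h = x \<bullet> h"
    using horizontal_curve .
  have c0: "c 0 = x" "(c has_vector_derivative cross3 ?n h) (at 0)"
    using c(1) by (auto simp: curve_through_def)
  have "\<forall>\<^sub>F t in nhds 0. dist (c 0) p \<le> dist (c t) p"
    using frontier_curve_in_B[OF assms(1) c]
  proof eventually_elim
    case (elim t)
    then have "d \<le> dist p (c t)" using far by blast
    then show ?case using assms(5) c0(1) by (simp add: dist_commute[of _ p])
  qed
  from inner_eq_0_at_local_min_dist[OF c0(2) this]
  have orth: "(p - x) \<bullet> cross3 ?n h = 0"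
    by (simp add: c0(1) inner_commute inner_diff_left inner_diff_right)
  have ph: "(p - x) \<bullet> h = 0"
    using assms(3) by (simp add: altitude_def inner_diff_left)
  define k where "k = (p - x) \<bullet> ?n"
  have px: "p - x = k *\<^sub>R ?n"
    using orthonormal_frame_expansion[OF hnormal_unit h hnormal_horizontal, of "p - x"] orth ph
    by (simp add: k_def)
  then have kd: "\<bar>k\<bar> = d"
    using assms(5) hnormal_unit by (simp add: dist_norm)
  have "\<not> 0 < k"
  proof
    assume "0 < k"
    then have "\<forall>\<^sub>F t in at_right 0. x + t *\<^sub>R (p - x) \<in> D"
      using enters_interior[OF ph] by (simp add: k_def inner_commute)
    \<comment> \<open>Points of the segment beyond \<open>x\<close> are closer to \<open>p\<close>
      than \<open>d\<close>, hence not in \<open>B\<close>.\<close>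
    moreover have "x + t *\<^sub>R (p - x) \<notin> B" if t: "0 < t" "t \<le> 1" for t
    proof
      assume "x + t *\<^sub>R (p - x) \<in> B"
      moreover have "altitude h a (x + t *\<^sub>R (p - x)) = altitude h a x"
        using ph by (simp add: altitude_def inner_add_left)
      ultimately have "d \<le> dist p (x + t *\<^sub>R (p - x))" by (rule far)
      also have "p - (x + t *\<^sub>R (p - x)) = (1 - t) *\<^sub>R (p - x)" by (simp add: algebra_simps)
      then have "dist p (x + t *\<^sub>R (p - x)) = (1 - t) * d"
        using t assms(5) by (simp add: dist_norm)
      finally show False using mult_pos_pos[OF t(1) \<open>0 < d\<close>] by (simp add: left_diff_distrib)
    qed
    ultimately show False
      using segment_leaves_outside[OF closed_D closed_layer convex_layer B(2,3) E(1,2) _ assms(1,2)]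
        E(3) assms(1) by blast
  qed
  then have "k = - d" using kd by simp
  then show ?thesis using px by (simp add: algebra_simps)
qed

lemma turning_bound_at_nearest_point:
  assumes motion: "admissible_motion v umax T r e w" "0 < T" "0 < v" "0 < d"
    and r: "\<And>t. t \<in> {0..T} \<Longrightarrow> r t \<in> E" "\<And>t. t \<in> {0..T} \<Longrightarrow> altitude h a (r t) = z"
    and \<beta>: "\<And>t. t \<in> {0..T} \<Longrightarrow> \<beta> t \<in> slice h a B z" "\<And>t. t \<in> {0..T} \<Longrightarrow> dist (r t) (\<beta> t) = d"
    and far: "\<And>t y. t \<in> {0..T} \<Longrightarrow> y \<in> slice h a B z \<Longrightarrow> d \<le> dist (r t) y"
    and uniq: "\<And>t y. t \<in> {0..T} \<Longrightarrow> y \<in> slice h a B z \<Longrightarrow> dist (r t) y = d \<Longrightarrow> y = \<beta> t"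
    and t0: "t0 \<in> {0..T}" and b: "b = \<beta> t0"
  defines "\<kappa> \<equiv> second_ff D b (unit_horizontal_tangent D h b) (unit_horizontal_tangent D h b)
      / sin (angle_between (inward_normal D b) h)"
  shows "\<bar>\<kappa>\<bar> * v \<le> umax * (1 + \<kappa> * d)"
proof -
  let ?F = "at t0 within {0..T}"
  have \<beta>B: "\<beta> t \<in> B" "altitude h a (\<beta> t) = z" if "t \<in> {0..T}" for t
    using \<beta>(1)[OF that] by (auto simp: slice_def)
  have bB: "b \<in> B" using \<beta>B t0 b by simp
  interpret tp: transversal_point D h b using transversal_point[OF bB] .
  have offset: "r t = \<beta> t - d *\<^sub>R hnormal D h (\<beta> t)" if "t \<in> {0..T}" for t
    using nearest_point_offset[OF \<beta>B(1) r(1) _ \<open>0 < d\<close> \<beta>(2)] far[of t] that \<beta>B r(2)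
    by (simp add: slice_def)
  have dr: "(r has_vector_derivative v *\<^sub>R e t) (at t within {0..T})" if "t \<in> {0..T}" for t
    using motion(1) that by (simp add: admissible_motion_def)
  have e1: "norm (e t) = 1" if "t \<in> {0..T}" for t
    using motion(1) that by (simp add: admissible_motion_def)
  have in_T: "\<forall>\<^sub>F s in ?F. s \<in> {0..T}"
    by (simp add: eventually_at_filter)
  \<comment> \<open>The extremality argument for the velocity needs two-sided variations of time. It
    is made at interior times, and \<open>t0\<close>, possibly an endpoint, is reached by
    continuity.\<close>
  have int_T: "\<forall>\<^sub>F s in ?F. s \<in> {0<..<T}"
    using in_T eventually_neq_at_within[of 0 t0 "{0..T}"] eventually_neq_at_within[of T t0 "{0..T}"]
    by eventually_elim auto
  have nontriv: "?F \<noteq> bot"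
    using t0 \<open>0 < T\<close> by (simp add: trivial_limit_within islimpt_Icc)
  have "closed (slice h a B z)"
  proof -
    have "slice h a B z = B \<inter> {x. h \<bullet> x = z - a}"
      by (auto simp: slice_def altitude_def inner_commute)
    then show ?thesis
      using closed_Int[OF compact_imp_closed[OF B(2)] closed_hyperplane[of h "z - a"]] by simp
  qed
  moreover have "(r \<longlongrightarrow> r t0) ?F"
    using has_vector_derivative_continuous[OF dr[OF t0]] by (simp add: continuous_within)
  moreover have "\<forall>\<^sub>F s in ?F. \<beta> s \<in> slice h a B z \<and> dist (r s) (\<beta> s) \<le> d"
    using in_T by eventually_elim (use \<beta> in simp)
  moreover have "d < dist (r t0) y" if "y \<in> slice h a B z" "y \<noteq> b" for y
    using far[OF t0 that(1)] uniq[OF t0 that(1)] that(2) b by (auto simp: less_le)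
  ultimately have \<beta>_lim: "(\<beta> \<longlongrightarrow> b) ?F"
    by (rule nearest_point_tendsto)
  \<comment> \<open>The distance to the fixed point \<open>\<beta> s\<close> is minimal at time
    \<open>s\<close>, so the velocity is orthogonal to the offset as well as to
    \<open>h\<close>.\<close>
  have tangent: "e s = cross3 (hnormal D h (\<beta> s)) h \<or> e s = - cross3 (hnormal D h (\<beta> s)) h"
    if s: "s \<in> {0<..<T}" for s
  proof -
    have sT: "s \<in> {0..T}" using s by simp
    interpret s: transversal_point D h "\<beta> s" using transversal_point \<beta>B sT by simp
    let ?n = "hnormal D h (\<beta> s)"
    have ds: "(r has_vector_derivative v *\<^sub>R e s) (at s)"
      using dr[OF sT] at_within_Icc_at[of 0 s T] s by simp
    have near: "\<forall>\<^sub>F t in nhds s. t \<in> {0<..<T}"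
      using eventually_nhds_in_open[of "{0<..<T}" s] s by simp
    then have "\<forall>\<^sub>F t in nhds s. dist (r s) (\<beta> s) \<le> dist (r t) (\<beta> s)"
      by eventually_elim (use far[OF _ \<beta>(1)[OF sT]] \<beta>(2)[OF sT] in simp)
    from inner_eq_0_at_local_min_dist[OF ds this]
    have "e s \<bullet> ?n = 0"
      using offset[OF sT] \<open>0 < v\<close> \<open>0 < d\<close> by (simp add: inner_diff_right)
    moreover have "e s \<bullet> h = 0"
    proof -
      have "((\<lambda>t. r t \<bullet> h) has_vector_derivative (v *\<^sub>R e s) \<bullet> h) (at s)"
        using bounded_linear.has_vector_derivative[OF bounded_linear_inner_left ds] .
      moreover have "((\<lambda>t. r t \<bullet> h) has_vector_derivative 0) (at s)"
      proof (rule has_vector_derivative_transform_within_open)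
        show "((\<lambda>t. z - a) has_vector_derivative 0) (at s)" by simp
        show "open {0<..<T}" "s \<in> {0<..<T}" using s by auto
        show "z - a = r t \<bullet> h" if "t \<in> {0<..<T}" for t
          using r(2)[of t] that by (simp add: altitude_def)
      qed
      ultimately show ?thesis
        using vector_derivative_unique_at \<open>0 < v\<close> by fastforce
    qed
    ultimately have es: "e s = (e s \<bullet> cross3 ?n h) *\<^sub>R cross3 ?n h" (is "_ = ?k *\<^sub>R _")
      using orthonormal_frame_expansion[OF s.hnormal_unit h s.hnormal_horizontal, of "e s"] by simp
    have "norm (cross3 ?n h) = 1"
      using norm_cross_orthogonal[OF h s.hnormal_horizontal] s.hnormal_unit by simp
    then have "\<bar>?k\<bar> = 1" using es e1[OF sT] by (metis norm_scaleR mult_1_right)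
    then have "?k = 1 \<or> ?k = - 1" by linarith
    then show ?thesis using es by auto
  qed
  have e_lip: "norm (e s - e t0) \<le> umax * \<bar>s - t0\<bar>" if "s \<in> {0..T}" for s
    using admissible_motion_Lipschitz[OF motion(1), of s t0]
      admissible_motion_Lipschitz[OF motion(1), of t0 s] that t0
    by (cases "s \<le> t0") (auto simp: norm_minus_commute)
  obtain g c where g: "(g has_derivative (\<lambda>w. (hnormal D h b + c *\<^sub>R h) \<bullet> w)) (at b)" "g b = (0::real)"
    "\<forall>\<^sub>F x in nhds b. x \<in> frontier D \<longrightarrow> g x = 0"
    using tp.local_equation .
  obtain \<nu> \<nu>' where \<nu>: "\<forall>\<^sub>F x in nhds b. x \<in> frontier D \<longrightarrow> hnormal D h x = \<nu> x"
    "(\<nu> has_derivative \<nu>') (at b)"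
    "\<nu>' (unit_horizontal_tangent D h b) = - \<kappa> *\<^sub>R unit_horizontal_tangent D h b"
    unfolding \<kappa>_def by (rule tp.hnormal_derivative)
  have \<nu>b: "hnormal D h b = \<nu> b"
    using eventually_nhds_x_imp_x[OF \<nu>(1)] tp.b by blast
  have \<tau>: "unit_horizontal_tangent D h b = cross3 (\<nu> b) h"
    using tp.tangent_eq \<nu>b by simp
  have \<nu>\<beta>: "\<forall>\<^sub>F s in ?F. hnormal D h (\<beta> s) = \<nu> (\<beta> s)"
    using eventually_compose_filterlim[OF \<nu>(1) \<beta>_lim] in_T
    by eventually_elim (use \<beta>B B(1) in blast)
  have g\<beta>: "\<forall>\<^sub>F s in ?F. g (\<beta> s) = 0"
    using eventually_compose_filterlim[OF g(3) \<beta>_lim] in_T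
    by eventually_elim (use \<beta>B B(1) in blast)
  have T1: "norm (cross3 (\<nu> b) h) = 1"
    using norm_cross_orthogonal[OF h tp.hnormal_horizontal] tp.hnormal_unit \<nu>b by simp
  have e_lim: "(e \<longlongrightarrow> e t0) ?F"
  proof -
    have "((\<lambda>s. umax * \<bar>s - t0\<bar>) \<longlongrightarrow> umax * \<bar>t0 - t0\<bar>) ?F"
      by (intro tendsto_intros)
    then have "((\<lambda>s. umax * \<bar>s - t0\<bar>) \<longlongrightarrow> 0) ?F" by simp
    moreover have "\<forall>\<^sub>F s in ?F. norm (e s - e t0) \<le> umax * \<bar>s - t0\<bar>"
      using in_T by eventually_elim (rule e_lip)
    ultimately have "((\<lambda>s. e s - e t0) \<longlongrightarrow> 0) ?F"
      by (rule Lim_null_comparison[rotated])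
    then show ?thesis by (rule LIM_zero_cancel)
  qed
  have "isCont \<nu> b" using \<nu>(2) has_derivative_continuous by blast
  then have "((\<lambda>s. \<nu> (\<beta> s)) \<longlongrightarrow> \<nu> b) ?F"
    using isCont_tendsto_compose \<beta>_lim by blast
  then have T_lim: "((\<lambda>s. cross3 (\<nu> (\<beta> s)) h) \<longlongrightarrow> cross3 (\<nu> b) h) ?F"
    by (rule bounded_linear.tendsto[OF bounded_linear_cross_left])
  \<comment> \<open>\<open>\<sigma>\<close> is the sense in which the slice is followed. It takes
    the values 1 and -1 near \<open>t0\<close> and converges, so it is eventually constant, and the
    increments of \<open>e\<close> and of the tangent have equal norms.\<close>
  define \<sigma> where "\<sigma> = (\<lambda>s. e s \<bullet> cross3 (\<nu> (\<beta> s)) h)"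
  have tangent_\<nu>: "\<forall>\<^sub>F s in ?F. e s = \<sigma> s *\<^sub>R cross3 (\<nu> (\<beta> s)) h \<and> \<bar>\<sigma> s\<bar> = 1"
    using int_T \<nu>\<beta>
  proof eventually_elim
    case (elim s)
    then have sT: "s \<in> {0..T}" by simp
    interpret s: transversal_point D h "\<beta> s" using transversal_point \<beta>B sT by simp
    let ?T = "cross3 (\<nu> (\<beta> s)) h"
    have "norm ?T = 1"
      using norm_cross_orthogonal[OF h s.hnormal_horizontal] s.hnormal_unit elim(2) by simp
    then have "?T \<bullet> ?T = 1" by (simp add: norm_eq_1)
    then show ?case using tangent[OF elim(1)] elim(2) by (auto simp: \<sigma>_def)
  qed
  have \<sigma>_lim: "(\<sigma> \<longlongrightarrow> e t0 \<bullet> cross3 (\<nu> b) h) ?F" (is "(_ \<longlongrightarrow> ?k) _")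
    unfolding \<sigma>_def by (intro tendsto_inner e_lim T_lim)
  have "((\<lambda>s. \<sigma> s *\<^sub>R cross3 (\<nu> (\<beta> s)) h) \<longlongrightarrow> ?k *\<^sub>R cross3 (\<nu> b) h) ?F"
    by (intro tendsto_scaleR \<sigma>_lim T_lim)
  moreover have "((\<lambda>s. \<sigma> s *\<^sub>R cross3 (\<nu> (\<beta> s)) h) \<longlongrightarrow> e t0) ?F"
    by (rule Lim_transform_eventually[OF e_lim]) (use tangent_\<nu> in eventually_elim, simp)
  ultimately have et0: "e t0 = ?k *\<^sub>R cross3 (\<nu> b) h"
    using tendsto_unique[OF nontriv] by blast
  have "\<bar>?k\<bar> = 1" using et0 e1[OF t0] T1 by (metis norm_scaleR mult_1_right)
  have "\<forall>\<^sub>F s in ?F. dist (\<sigma> s) ?k < 1"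
    using tendstoD[OF \<sigma>_lim] by simp
  with tangent_\<nu> have e_eq: "\<forall>\<^sub>F s in ?F. norm (e s - e t0) = norm (cross3 (\<nu> (\<beta> s)) h - cross3 (\<nu> b) h)"
  proof eventually_elim
    case (elim s)
    then have "\<sigma> s = ?k" using \<open>\<bar>?k\<bar> = 1\<close> by (auto simp: dist_real_def)
    then have "e s - e t0 = ?k *\<^sub>R (cross3 (\<nu> (\<beta> s)) h - cross3 (\<nu> b) h)"
      using elim(1) et0 by (metis scaleR_diff_right)
    then show ?case using \<open>\<bar>?k\<bar> = 1\<close> by (metis norm_scaleR mult_1)
  qed
  show ?thesis
  proof (rule turning_bound[where r = r and e = e and \<beta> = \<beta> and \<nu> = \<nu> and \<nu>' = \<nu>' and h = h
        and b = b and g = g and c = c and d = d and F = ?F and t = t0])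
    show "?F = ?F" "?F \<noteq> bot" "norm h = 1" "0 < v" by (fact refl nontriv h \<open>0 < v\<close>)+
    show "norm (\<nu> b) = 1" "\<nu> b \<bullet> h = 0"
      using tp.hnormal_unit tp.hnormal_horizontal \<nu>b by simp_all
    show "(\<beta> \<longlongrightarrow> b) ?F" by fact
    show "\<forall>\<^sub>F s in ?F. (\<beta> s - b) \<bullet> h = 0"
      using in_T
    proof eventually_elim
      case (elim s)
      then show ?case
        using \<beta>B(2)[OF elim] \<beta>B(2)[OF t0] b by (simp add: altitude_def inner_diff_left)
    qed
    show "(g has_derivative (\<lambda>w. (\<nu> b + c *\<^sub>R h) \<bullet> w)) (at b)" using g(1) \<nu>b by simp
    show "g b = 0" "\<forall>\<^sub>F s in ?F. g (\<beta> s) = 0" by fact+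
    show "(\<nu> has_derivative \<nu>') (at b)" by fact
    show "\<nu>' (cross3 (\<nu> b) h) = - \<kappa> *\<^sub>R cross3 (\<nu> b) h" using \<nu>(3) \<tau> by simp
    show "\<forall>\<^sub>F s in ?F. r s = \<beta> s - d *\<^sub>R \<nu> (\<beta> s)"
      using in_T \<nu>\<beta> by eventually_elim (use offset in metis)
    show "r t0 = b - d *\<^sub>R \<nu> b" using offset[OF t0] b \<nu>b by simp
    show "(r has_vector_derivative v *\<^sub>R e t0) (at t0 within {0..T})" using dr[OF t0] .
    show "norm (e t0) = 1" using e1[OF t0] .
    show "\<forall>\<^sub>F s in ?F. norm (e s - e t0) = norm (cross3 (\<nu> (\<beta> s)) h - cross3 (\<nu> b) h)" by fact
    show "\<forall>\<^sub>F s in ?F. norm (e s - e t0) \<le> umax * \<bar>s - t0\<bar>"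
      using in_T by eventually_elim (rule e_lip)
    show "\<forall>\<^sub>F s in ?F. 0 \<le> (r s - r t0) \<bullet> (\<beta> s - b)"
      using in_T
    proof eventually_elim
      case (elim s)
      \<comment> \<open>Each position is at least as close to its own nearest point as to the other
        one; adding the two squared inequalities gives the monotonicity.\<close>
      have "(dist (r s) (\<beta> s))\<^sup>2 \<le> (dist (r s) b)\<^sup>2" "(dist (r t0) b)\<^sup>2 \<le> (dist (r t0) (\<beta> s))\<^sup>2"
        using far[OF elim \<beta>(1)[OF t0]] far[OF t0 \<beta>(1)[OF elim]] \<beta>(2)[OF elim] \<beta>(2)[OF t0] b \<open>0 < d\<close>
        by (auto intro!: power_mono)
      then show ?case
        by (simp add: dist_norm power2_norm_eq_inner inner_diff_left inner_diff_right inner_commute)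
    qed
  qed
qed

end

theorem lemma3p1:
  fixes v umax d0 hmin hmax a :: real
    and hv :: "real^3"
    and D Bdag B Dout :: "(real^3) set"
  assumes "v > 0" and "umax > 0" and "d0 > 0"
    and "norm hv = 1" and "hmin < hmax"
    and "compact D" and "Ck_domain 3 D"
    and "Bdag \<in> components (frontier D)"
    and "\<forall>b \<in> Bdag \<inter> layer hv a hmin hmax. \<not> collinear {0, inward_normal D b, hv}"
    and "B \<in> components (Bdag \<inter> layer hv a hmin hmax)"
    and "Dout \<in> components (layer hv a hmin hmax - D)" and "B \<subseteq> frontier Dout"
    and "\<exists>r\<in>Dout. hdist hv a B r = d0"
    and "\<forall>r\<in>Dout. hdist hv a B r = d0 \<longrightarrow> (\<exists>!b. is_hnearest hv a B r b)"
    and "\<forall>z\<in>{hmin..hmax}. can_circumnavigate v umax hv a Dout B d0 z"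
  shows "\<forall>b\<in>B. ereal (v / umax) \<le>
      ereal (sin (angle_between (inward_normal D b) hv)) /
        ereal \<bar>second_ff D b (unit_horizontal_tangent D hv b) (unit_horizontal_tangent D hv b)\<bar>
      + ereal (d0 * sgn (second_ff D b (unit_horizontal_tangent D hv b) (unit_horizontal_tangent D hv b)))"
proof
  fix b assume b: "b \<in> B"
  let ?L = "layer hv a hmin hmax"
  have closed_D: "closed D" using assms(6) by (rule compact_imp_closed)
  have Bdag: "Bdag \<subseteq> frontier D" and Bsub: "B \<subseteq> Bdag \<inter> ?L"
    using assms(8,10) in_components_subset by blast+
  have slab: "?L = {x. x \<bullet> hv \<in> {hmin - a..hmax - a}}"
    by (auto simp: layer_def altitude_def)
  have "closed ?L"
    using closed_Int[OF closed_halfspace_ge[of "hmin - a" hv] closed_halfspace_le[of hv "hmax - a"]]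
    by (simp add: slab Int_def inner_commute)
  have "compact (frontier D)" using assms(6) by (rule compact_frontier)
  then have "compact Bdag" using assms(8) by (rule compact_components)
  then have "compact (Bdag \<inter> ?L)" using \<open>closed ?L\<close> by (rule compact_Int_closed)
  then have compact_B: "compact B" using assms(10) by (rule compact_components)
  \<comment> \<open>A connected piece of the boundary in the layer around \<open>x\<close> is
    absorbed by the component \<open>Bdag\<close>, and then by the component
    \<open>B\<close>.\<close>
  have "openin (top_of_set (frontier D \<inter> ?L)) B"
    unfolding openin_subopen[of _ B]
  proof
    fix x assume x: "x \<in> B"
    interpret transversal_point D hv x
      using x Bdag Bsub assms(4,7,9) closed_D by unfold_locales blast+
    obtain W where W: "open W" "x \<in> W" "connected (W \<inter> (frontier D \<inter> ?L))"
      unfolding slab by (rule connected_slab)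
    have x_in: "x \<in> W \<inter> (frontier D \<inter> ?L)" using x W(2) Bsub Bdag by blast
    have "W \<inter> (frontier D \<inter> ?L) \<subseteq> Bdag"
      by (rule components_maximal[OF assms(8) W(3)]) (use x_in x Bsub in blast)+
    then have "W \<inter> (frontier D \<inter> ?L) \<subseteq> Bdag \<inter> ?L" by blast
    then have "W \<inter> (frontier D \<inter> ?L) \<subseteq> B"
      by (rule components_maximal[OF assms(10) W(3)]) (use x_in x in blast)
    then show "\<exists>T. openin (top_of_set (frontier D \<inter> ?L)) T \<and> x \<in> T \<and> T \<subseteq> B"
      using x_in W(1) openin_open_Int[of W "frontier D \<inter> ?L"] by (metis Int_commute)
  qed
  moreover have "connected Dout" "Dout \<subseteq> ?L - D"
    using assms(11) in_components_connected in_components_subset by blast+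
  moreover have "B \<subseteq> closure Dout"
    using assms(12) by (auto simp: frontier_def)
  ultimately interpret layered_boundary D B Dout hv a hmin hmax
    using assms(4,7,9) closed_D compact_B Bdag Bsub by unfold_locales blast+
  define z where "z = altitude hv a b"
  have "z \<in> {hmin..hmax}" using b Bsub by (auto simp: layer_def z_def)
  then have "can_circumnavigate v umax hv a Dout B d0 z" using assms(15) by blast
  then obtain T r e u where T: "0 < T" "admissible_motion v umax T r e u"
    and motion: "\<forall>t\<in>{0..T}. r t \<in> Dout \<and> altitude hv a (r t) = z \<and> infdist (r t) (slice hv a B z) = d0"
    and im: "(\<lambda>t. hnearest hv a B (r t)) ` {0..T} = slice hv a B z"
    unfolding can_circumnavigate_def by (elim exE conjE)
  have r: "r t \<in> Dout" "altitude hv a (r t) = z" "infdist (r t) (slice hv a B z) = d0"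
    if "t \<in> {0..T}" for t
    using motion that by blast+
  define \<beta> where "\<beta> = (\<lambda>t. hnearest hv a B (r t))"
  have hdist: "hdist hv a B (r t) = d0" if "t \<in> {0..T}" for t
    using r(2,3)[OF that] by (simp add: hdist_def)
  have ex1: "\<exists>!y. is_hnearest hv a B (r t) y" if "t \<in> {0..T}" for t
    using assms(14) r(1)[OF that] hdist[OF that] by blast
  have near_iff: "is_hnearest hv a B (r t) y \<longleftrightarrow> y \<in> slice hv a B z \<and> dist (r t) y = d0"
    if "t \<in> {0..T}" for t y
    using r(2)[OF that] hdist[OF that] by (simp add: is_hnearest_def)
  have \<beta>_near: "is_hnearest hv a B (r t) (\<beta> t)" if "t \<in> {0..T}" for t
    unfolding \<beta>_def hnearest_def using theI'[OF ex1[OF that]] .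
  have "b \<in> slice hv a B z" using b by (simp add: slice_def z_def)
  \<comment> \<open>The nearest point runs over the whole slice, so the given \<open>b\<close> is
    reached at some time.\<close>
  then obtain t0 where t0: "t0 \<in> {0..T}" "b = \<beta> t0"
    using im unfolding \<beta>_def by blast
  let ?II = "second_ff D b (unit_horizontal_tangent D hv b) (unit_horizontal_tangent D hv b)"
  let ?s = "sin (angle_between (inward_normal D b) hv)"
  have "\<bar>?II / ?s\<bar> * v \<le> umax * (1 + ?II / ?s * d0)"
  proof (rule turning_bound_at_nearest_point[where r = r and \<beta> = \<beta> and z = z,
        OF T(2,1) assms(1,3) r(1,2) _ _ _ _ t0])
    fix t assume t: "t \<in> {0..T}"
    show "\<beta> t \<in> slice hv a B z" "dist (r t) (\<beta> t) = d0"
      using \<beta>_near[OF t] near_iff[OF t] by blast+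
    show "d0 \<le> dist (r t) y" if "y \<in> slice hv a B z" for y
      using infdist_le[OF that, of "r t"] r(3)[OF t] by simp
    show "y = \<beta> t" if "y \<in> slice hv a B z" "dist (r t) y = d0" for y
      using ex1[OF t] \<beta>_near[OF t] near_iff[OF t] that by blast
  qed
  moreover have s: "0 < ?s"
    using transversal_point.sin_angle_pos[OF transversal_point[OF b]] .
  ultimately have bound: "\<bar>?II\<bar> * v \<le> umax * (?s + ?II * d0)"
    by (simp add: field_simps abs_mult)
  show "ereal (v / umax) \<le> ereal ?s / ereal \<bar>?II\<bar> + ereal (d0 * sgn ?II)"
  proof (cases "?II = 0")
    case True
    \<comment> \<open>In \<open>ereal\<close> a positive number divided by 0 is infinite, so the
      bound is trivial here.\<close>
    then show ?thesis using s by (simp add: divide_ereal_def)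
  next
    case False
    then have "v / umax \<le> (?s + ?II * d0) / \<bar>?II\<bar>"
      using bound assms(2) by (simp add: field_simps)
    also have "\<dots> = ?s / \<bar>?II\<bar> + d0 * sgn ?II"
      using False by (simp add: add_divide_distrib sgn_real_def abs_if)
    finally show ?thesis using False by simp
  qed
qed

end
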